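(* Let $(M_1,F_1)$ and $(M_2,F_2)$ be Finsler manifolds of dimensions $n$ and $m$, let $f:M_1\to\mathbb{R}$ be a smooth nowhere vanishing function, and let $(M,F)$ be the warped product Finsler manifold $M=M_1\times M_2$, $F=\sqrt{F_1^2+f^2F_2^2}$. Let $\tilde G$ and $\tilde J$ be the Oproiu-type metric and almost complex structure on the tangent bundle defined in the context (depending on constants $A,B$ and a function $\tau$). Then $(TM,\tilde J,\tilde G)$ is a Kähler manifold if and only if, for all indices $a,b,d\in\{1,\dots,n+m\}$, $$P_a^c\frac{\partial P_b^d}{\partial\mathbf{y}^c}-P_b^c\frac{\partial P_a^d}{\partial\mathbf{y}^c}-R^d_{\ ab}=0\qquad\text{and}\qquad P_{b|a}^d-P_{a|b}^d+P_b^cB_{ac}^d-P_a^cB_{cb}^d=0 .$$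
   Context: Indices $a,b,c,\dots$ range over $1,\dots,n+m$; repeated indices are summed. $(\mathbf{x}^a,\mathbf{y}^a)$ are the local coordinates on $TM$ induced from local coordinates $\mathbf{x}=(x,u)$ on $M_1\times M_2$, with $\mathbf{y}=(y,v)$. $F$ and all objects below are defined on $TM^0:=TM_1^0\oplus TM_2^0$ (nonzero tangent vectors in each factor). $g_{ab}=\frac12\frac{\partial^2F^2}{\partial\mathbf{y}^a\partial\mathbf{y}^b}$, with inverse $g^{ab}$; $\mathbf{y}_a=g_{ab}\mathbf{y}^b$. Nonlinear connection: $B^a=\frac14g^{ab}\big(\frac{\partial^2F^2}{\partial\mathbf{y}^b\partial\mathbf{x}^c}\mathbf{y}^c-\frac{\partial F^2}{\partial\mathbf{x}^b}\big)$ are the semi-spray coefficients of $F$, $B^a_b=\frac{\partial B^a}{\partial\mathbf{y}^b}$, $B^d_{ab}=\frac{\partial B^d_a}{\partial\mathbf{y}^b}$, $\frac{\delta^*}{\delta^*\mathbf{x}^a}=\frac{\partial}{\partial\mathbf{x}^a}-B^b_a\frac{\partial}{\partial\mathbf{y}^b}$, $\delta^*\mathbf{y}^a=d\mathbf{y}^a+B^a_bd\mathbf{x}^b$, and $R^c_{\ ab}$ is defined by $\big[\frac{\delta^*}{\delta^*\mathbf{x}^a},\frac{\delta^*}{\delta^*\mathbf{x}^b}\big]=R^c_{\ ab}\frac{\partial}{\partial\mathbf{y}^c}$. Metric and almost complex structure: let $A,B$ be real constants and $\tau$ a smooth real function of $F^2$, such that the expressions below are defined ($A,B\neq0$, $B+F^2\tau(F^2)\neq0$)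 and $\tilde G$ is a Riemannian metric. Put $$P_{ab}=\tfrac1Ag_{ab}+\tfrac{\tau(F^2)}{AB}\mathbf{y}_a\mathbf{y}_b,\quad Q_{ab}=Ag_{ab}-\tfrac{A\tau(F^2)}{B+F^2\tau(F^2)}\mathbf{y}_a\mathbf{y}_b,\quad P_a^b=P_{ac}g^{cb},\quad Q_a^b=Q_{ac}g^{cb},$$ $$\tilde G=P_{ab}\,d\mathbf{x}^a\otimes d\mathbf{x}^b+Q_{ab}\,\delta^*\mathbf{y}^a\otimes\delta^*\mathbf{y}^b,\qquad \tilde J\tfrac{\partial}{\partial\mathbf{y}^a}=Q_a^b\tfrac{\delta^*}{\delta^*\mathbf{x}^b},\quad \tilde J\tfrac{\delta^*}{\delta^*\mathbf{x}^a}=-P_a^b\tfrac{\partial}{\partial\mathbf{y}^b}.$$ Finally $P^d_{b|c}=\frac{\delta^*P^d_b}{\delta^*\mathbf{x}^c}$ (i.e. the vector field $\frac{\delta^*}{\delta^*\mathbf{x}^c}$ applied to the component function $P^d_b$). Kähler means: $\tilde G$ is $\tilde J$-Hermitian, the 2-form $\tilde\Omega(X,Y)=\tilde G(X,\tilde JY)$ is closed, and $\tilde J$ is integrable (vanishing Nijenhuis tensor). *)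

theory Defs
  imports "HOL-Analysis.Analysis"
begin

section \<open>Smooth maps, manifolds and tangent bundles\<close>

text \<open>Only meant for open sets, in finite dimension: \<open>C\<^sup>k\<close> in terms of iterated directional
  derivatives.\<close>

primrec Ck_on :: "nat \<Rightarrow> 'e::real_normed_vector set \<Rightarrow> ('e \<Rightarrow> 'f::real_normed_vector) \<Rightarrow> bool" where
  "Ck_on 0 S f \<longleftrightarrow> continuous_on S f"
| "Ck_on (Suc k) S f \<longleftrightarrow> (\<forall>x\<in>S. f differentiable (at x)) \<and>
     (\<forall>v. Ck_on k S (\<lambda>x. frechet_derivative f (at x) v))"

definition smooth_on :: "'e::real_normed_vector set \<Rightarrow> ('e \<Rightarrow> 'f::real_normed_vector) \<Rightarrow> bool" where
  "smooth_on S f \<longleftrightarrow> (\<forall>k. Ck_on k S f)"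

text \<open>A chart is its domain together with a coordinate map; the values of the map off the domain
  are irrelevant. The manifold itself is the whole type \<open>'p\<close>.\<close>

type_synonym ('p, 'n) chart = "'p set \<times> ('p \<Rightarrow> real ^ 'n)"

definition chart_inv :: "('p, 'n) chart \<Rightarrow> real ^ 'n \<Rightarrow> 'p" where
  "chart_inv c = inv_into (fst c) (snd c)"

definition is_chart :: "('p::topological_space, 'n::finite) chart \<Rightarrow> bool" where
  "is_chart c \<longleftrightarrow> open (fst c) \<and> open (snd c ` fst c) \<and>
     homeomorphism (fst c) (snd c ` fst c) (snd c) (chart_inv c)"

definition transition :: "('p, 'n) chart \<Rightarrow> ('p, 'n) chart \<Rightarrow> real ^ 'n \<Rightarrow> real ^ 'n" where
  "transition c c' = snd c' \<circ> chart_inv c"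

definition smooth_atlas ::
  "('p::{t2_space,second_countable_topology}, 'n::finite) chart set \<Rightarrow> bool" where
  "smooth_atlas \<A> \<longleftrightarrow> (\<forall>c\<in>\<A>. is_chart c) \<and> \<Union>(fst ` \<A>) = UNIV \<and>
     (\<forall>c\<in>\<A>. \<forall>c'\<in>\<A>. smooth_on (snd c ` (fst c \<inter> fst c')) (transition c c'))"

definition smooth_fun :: "('p, 'n::finite) chart set \<Rightarrow> ('p \<Rightarrow> real) \<Rightarrow> bool" where
  "smooth_fun \<A> f \<longleftrightarrow> (\<forall>c\<in>\<A>. smooth_on (snd c ` fst c) (f \<circ> chart_inv c))"

text \<open>A tangent vector at \<open>p\<close> is the family of its components in all charts around \<open>p\<close>,
  transforming with the Jacobians of the transition maps (and set to \<open>0\<close> at all other charts).\<close>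

type_synonym ('p, 'n) tvec = "('p, 'n) chart \<Rightarrow> real ^ 'n"

definition tangent_space :: "('p, 'n::finite) chart set \<Rightarrow> 'p \<Rightarrow> ('p, 'n) tvec set" where
  "tangent_space \<A> p = {v.
     (\<forall>c\<in>\<A>. \<forall>c'\<in>\<A>. p \<in> fst c \<longrightarrow> p \<in> fst c' \<longrightarrow>
        v c' = frechet_derivative (transition c c') (at (snd c p)) (v c)) \<and>
     (\<forall>c. c \<notin> \<A> \<or> p \<notin> fst c \<longrightarrow> v c = 0)}"

definition tangent_bundle :: "('p, 'n::finite) chart set \<Rightarrow> ('p \<times> ('p, 'n) tvec) set" where
  "tangent_bundle \<A> = {(p, v). v \<in> tangent_space \<A> p}"

definition slit_bundle :: "('p, 'n::finite) chart set \<Rightarrow> ('p \<times> ('p, 'n) tvec) set" where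
  "slit_bundle \<A> = {(p, v) \<in> tangent_bundle \<A>. v \<noteq> (\<lambda>_. 0)}"

text \<open>The inverse of the chart of the tangent bundle induced by \<open>c\<close>: the point with coordinates
  \<open>x\<close>, and the tangent vector there whose components in \<open>c\<close> are \<open>y\<close>.\<close>

definition of_coords ::
  "('p, 'n::finite) chart set \<Rightarrow> ('p, 'n) chart \<Rightarrow> (real ^ 'n) \<times> (real ^ 'n) \<Rightarrow> 'p \<times> ('p, 'n) tvec" where
  "of_coords \<A> c = (\<lambda>(x, y). (chart_inv c x,
     \<lambda>c'. if c' \<in> \<A> \<and> chart_inv c x \<in> fst c'
           then frechet_derivative (transition c c') (at x) y else 0))"

definition slit_coords :: "('p, 'n::finite) chart \<Rightarrow> ((real ^ 'n) \<times> (real ^ 'n)) set" where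
  "slit_coords c = (snd c ` fst c) \<times> (- {0})"


section \<open>Coordinate expressions on the tangent bundle\<close>

text \<open>Here \<open>F\<close> is a coordinate expression: a function of \<open>(x, y)\<close>.\<close>

type_synonym 'i pt = "(real ^ 'i) \<times> (real ^ 'i)"

definition dx :: "'i::finite \<Rightarrow> ('i pt \<Rightarrow> real) \<Rightarrow> 'i pt \<Rightarrow> real" where
  "dx a h p = frechet_derivative h (at p) (axis a 1, 0)"

definition dy :: "'i::finite \<Rightarrow> ('i pt \<Rightarrow> real) \<Rightarrow> 'i pt \<Rightarrow> real" where
  "dy a h p = frechet_derivative h (at p) (0, axis a 1)"

definition gmet :: "('i pt \<Rightarrow> real) \<Rightarrow> 'i::finite \<Rightarrow> 'i \<Rightarrow> 'i pt \<Rightarrow> real" where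
  "gmet F a b p = 1/2 * dy a (dy b (\<lambda>q. (F q)\<^sup>2)) p"

definition ginv :: "('i pt \<Rightarrow> real) \<Rightarrow> 'i::finite \<Rightarrow> 'i \<Rightarrow> 'i pt \<Rightarrow> real" where
  "ginv F a b p = matrix_inv (\<chi> i j. gmet F i j p) $ a $ b"

definition ylow :: "('i pt \<Rightarrow> real) \<Rightarrow> 'i::finite \<Rightarrow> 'i pt \<Rightarrow> real" where
  "ylow F a p = (\<Sum>b\<in>UNIV. gmet F a b p * snd p $ b)"

definition finsler_manifold ::
  "('p::{t2_space,second_countable_topology}, 'n::finite) chart set \<Rightarrow>
   ('p \<times> ('p, 'n) tvec \<Rightarrow> real) \<Rightarrow> bool" where
  "finsler_manifold \<A> F \<longleftrightarrow> smooth_atlas \<A> \<and>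
     (\<forall>z\<in>tangent_bundle \<A>. 0 \<le> F z) \<and>
     (\<forall>(p, v)\<in>tangent_bundle \<A>. \<forall>t>0. F (p, \<lambda>c. t *\<^sub>R v c) = t * F (p, v)) \<and>
     (\<forall>c\<in>\<A>. smooth_on (slit_coords c) (F \<circ> of_coords \<A> c) \<and>
        (\<forall>q\<in>slit_coords c. \<forall>w. w \<noteq> 0 \<longrightarrow>
           0 < (\<Sum>a\<in>UNIV. \<Sum>b\<in>UNIV. gmet (F \<circ> of_coords \<A> c) a b q * w $ a * w $ b)))"

definition lie_bracket ::
  "('e::real_normed_vector \<Rightarrow> 'e) \<Rightarrow> ('e \<Rightarrow> 'e) \<Rightarrow> 'e \<Rightarrow> 'e" where
  "lie_bracket X Y p = frechet_derivative Y (at p) (X p) - frechet_derivative X (at p) (Y p)"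

text \<open>\<open>spray F a\<close> is \<open>B\<^sup>a\<close>, \<open>conn F a b\<close> is \<open>B\<^sup>a\<^sub>b\<close> and \<open>dconn F d a b\<close> is \<open>B\<^sup>d\<^sub>a\<^sub>b\<close>: the
  upper index comes first.\<close>

definition spray :: "('i pt \<Rightarrow> real) \<Rightarrow> 'i::finite \<Rightarrow> 'i pt \<Rightarrow> real" where
  "spray F a p = 1/4 * (\<Sum>b\<in>UNIV. ginv F a b p *
     ((\<Sum>c\<in>UNIV. dy b (dx c (\<lambda>q. (F q)\<^sup>2)) p * snd p $ c) - dx b (\<lambda>q. (F q)\<^sup>2) p))"

definition conn :: "('i pt \<Rightarrow> real) \<Rightarrow> 'i::finite \<Rightarrow> 'i \<Rightarrow> 'i pt \<Rightarrow> real" where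
  "conn F a b = dy b (spray F a)"

definition dconn :: "('i pt \<Rightarrow> real) \<Rightarrow> 'i::finite \<Rightarrow> 'i \<Rightarrow> 'i \<Rightarrow> 'i pt \<Rightarrow> real" where
  "dconn F d a b = dy b (conn F d a)"

definition vert :: "'i::finite \<Rightarrow> 'i pt \<Rightarrow> 'i pt" where
  "vert a p = (0, axis a 1)"

definition hor :: "('i pt \<Rightarrow> real) \<Rightarrow> 'i::finite \<Rightarrow> 'i pt \<Rightarrow> 'i pt" where
  "hor F a p = (axis a 1, 0) - (\<Sum>b\<in>UNIV. conn F b a p *\<^sub>R vert b p)"

text \<open>The dual coframe: \<open>d\<^bold>x\<^sup>a\<close> and \<open>\<delta>\<^sup>*\<^bold>y\<^sup>a\<close>, applied to a tangent vector \<open>\<xi>\<close> at \<open>p\<close>.\<close>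

definition cox :: "'i::finite \<Rightarrow> 'i pt \<Rightarrow> real" where
  "cox a \<xi> = fst \<xi> $ a"

definition coy :: "('i pt \<Rightarrow> real) \<Rightarrow> 'i::finite \<Rightarrow> 'i pt \<Rightarrow> 'i pt \<Rightarrow> real" where
  "coy F a p \<xi> = snd \<xi> $ a + (\<Sum>b\<in>UNIV. conn F a b p * fst \<xi> $ b)"

text \<open>\<open>curv F c a b\<close> is \<open>R\<^sup>c\<^sub>a\<^sub>b\<close>. The brackets of the horizontal fields are vertical, so their
  vertical components determine them.\<close>

definition curv :: "('i pt \<Rightarrow> real) \<Rightarrow> 'i::finite \<Rightarrow> 'i \<Rightarrow> 'i \<Rightarrow> 'i pt \<Rightarrow> real" where
  "curv F c a b p = snd (lie_bracket (hor F a) (hor F b) p) $ c"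

definition Plow :: "('i pt \<Rightarrow> real) \<Rightarrow> real \<Rightarrow> real \<Rightarrow> (real \<Rightarrow> real) \<Rightarrow>
    'i::finite \<Rightarrow> 'i \<Rightarrow> 'i pt \<Rightarrow> real" where
  "Plow F A B \<tau> a b p = 1 / A * gmet F a b p + \<tau> ((F p)\<^sup>2) / (A * B) * ylow F a p * ylow F b p"

definition Qlow :: "('i pt \<Rightarrow> real) \<Rightarrow> real \<Rightarrow> real \<Rightarrow> (real \<Rightarrow> real) \<Rightarrow>
    'i::finite \<Rightarrow> 'i \<Rightarrow> 'i pt \<Rightarrow> real" where
  "Qlow F A B \<tau> a b p = A * gmet F a b p
     - A * \<tau> ((F p)\<^sup>2) / (B + (F p)\<^sup>2 * \<tau> ((F p)\<^sup>2)) * ylow F a p * ylow F b p"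

text \<open>\<open>Pmix F A B \<tau> a b\<close> is \<open>P\<^sub>a\<^sup>b\<close>: the lower index comes first.\<close>

definition Pmix :: "('i pt \<Rightarrow> real) \<Rightarrow> real \<Rightarrow> real \<Rightarrow> (real \<Rightarrow> real) \<Rightarrow>
    'i::finite \<Rightarrow> 'i \<Rightarrow> 'i pt \<Rightarrow> real" where
  "Pmix F A B \<tau> a b p = (\<Sum>c\<in>UNIV. Plow F A B \<tau> a c p * ginv F c b p)"

definition Qmix :: "('i pt \<Rightarrow> real) \<Rightarrow> real \<Rightarrow> real \<Rightarrow> (real \<Rightarrow> real) \<Rightarrow>
    'i::finite \<Rightarrow> 'i \<Rightarrow> 'i pt \<Rightarrow> real" where
  "Qmix F A B \<tau> a b p = (\<Sum>c\<in>UNIV. Qlow F A B \<tau> a c p * ginv F c b p)"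

text \<open>\<open>Phder F A B \<tau> d b c\<close> is \<open>P\<^sup>d\<^sub>b\<^sub>|\<^sub>c\<close>.\<close>

definition Phder :: "('i pt \<Rightarrow> real) \<Rightarrow> real \<Rightarrow> real \<Rightarrow> (real \<Rightarrow> real) \<Rightarrow>
    'i::finite \<Rightarrow> 'i \<Rightarrow> 'i \<Rightarrow> 'i pt \<Rightarrow> real" where
  "Phder F A B \<tau> d b c p = frechet_derivative (Pmix F A B \<tau> b d) (at p) (hor F c p)"

definition Gtilde :: "('i pt \<Rightarrow> real) \<Rightarrow> real \<Rightarrow> real \<Rightarrow> (real \<Rightarrow> real) \<Rightarrow>
    'i::finite pt \<Rightarrow> 'i pt \<Rightarrow> 'i pt \<Rightarrow> real" where
  "Gtilde F A B \<tau> p \<xi> \<eta> =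
     (\<Sum>a\<in>UNIV. \<Sum>b\<in>UNIV. Plow F A B \<tau> a b p * cox a \<xi> * cox b \<eta>) +
     (\<Sum>a\<in>UNIV. \<Sum>b\<in>UNIV. Qlow F A B \<tau> a b p * coy F a p \<xi> * coy F b p \<eta>)"

text \<open>The linear map that sends the vertical frame vector number \<open>a\<close> to \<open>\<Sum>\<^sub>b Q\<^sub>a\<^sup>b hor b\<close>, and the
  horizontal one to \<open>- \<Sum>\<^sub>b P\<^sub>a\<^sup>b vert b\<close>.\<close>

definition Jtilde :: "('i pt \<Rightarrow> real) \<Rightarrow> real \<Rightarrow> real \<Rightarrow> (real \<Rightarrow> real) \<Rightarrow>
    'i::finite pt \<Rightarrow> 'i pt \<Rightarrow> 'i pt" where
  "Jtilde F A B \<tau> p \<xi> =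
     (\<Sum>a\<in>UNIV. coy F a p \<xi> *\<^sub>R (\<Sum>b\<in>UNIV. Qmix F A B \<tau> a b p *\<^sub>R hor F b p)) -
     (\<Sum>a\<in>UNIV. cox a \<xi> *\<^sub>R (\<Sum>b\<in>UNIV. Pmix F A B \<tau> a b p *\<^sub>R vert b p))"


section \<open>Riemannian metrics and Kaehler structures on an open set of coordinates\<close>

definition riemannian_on ::
  "'e::real_normed_vector set \<Rightarrow> ('e \<Rightarrow> 'e \<Rightarrow> 'e \<Rightarrow> real) \<Rightarrow> bool" where
  "riemannian_on U G \<longleftrightarrow> (\<forall>\<xi> \<eta>. smooth_on U (\<lambda>p. G p \<xi> \<eta>)) \<and>
     (\<forall>p\<in>U. bilinear (G p) \<and> (\<forall>\<xi> \<eta>. G p \<xi> \<eta> = G p \<eta> \<xi>) \<and> (\<forall>\<xi>. \<xi> \<noteq> 0 \<longrightarrow> 0 < G p \<xi> \<xi>))"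

definition hermitian_on ::
  "'e set \<Rightarrow> ('e \<Rightarrow> 'e \<Rightarrow> 'e \<Rightarrow> real) \<Rightarrow> ('e \<Rightarrow> 'e \<Rightarrow> 'e) \<Rightarrow> bool" where
  "hermitian_on U G J \<longleftrightarrow> (\<forall>p\<in>U. \<forall>\<xi> \<eta>. G p (J p \<xi>) (J p \<eta>) = G p \<xi> \<eta>)"

definition ext_deriv ::
  "('e::real_normed_vector \<Rightarrow> 'e \<Rightarrow> 'e \<Rightarrow> real) \<Rightarrow> 'e \<Rightarrow> 'e \<Rightarrow> 'e \<Rightarrow> 'e \<Rightarrow> real" where
  "ext_deriv \<omega> p u v w =
     frechet_derivative (\<lambda>q. \<omega> q v w) (at p) u
     - frechet_derivative (\<lambda>q. \<omega> q u w) (at p) v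
     + frechet_derivative (\<lambda>q. \<omega> q u v) (at p) w"

definition closed_form_on ::
  "'e::real_normed_vector set \<Rightarrow> ('e \<Rightarrow> 'e \<Rightarrow> 'e \<Rightarrow> real) \<Rightarrow> bool" where
  "closed_form_on U \<omega> \<longleftrightarrow> (\<forall>p\<in>U. \<forall>u v w. ext_deriv \<omega> p u v w = 0)"

definition nijenhuis ::
  "('e::real_normed_vector \<Rightarrow> 'e \<Rightarrow> 'e) \<Rightarrow> ('e \<Rightarrow> 'e) \<Rightarrow> ('e \<Rightarrow> 'e) \<Rightarrow> 'e \<Rightarrow> 'e" where
  "nijenhuis J X Y p =
     lie_bracket (\<lambda>q. J q (X q)) (\<lambda>q. J q (Y q)) p
     - J p (lie_bracket (\<lambda>q. J q (X q)) Y p)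
     - J p (lie_bracket X (\<lambda>q. J q (Y q)) p)
     - lie_bracket X Y p"

definition integrable_on_open ::
  "'e::real_normed_vector set \<Rightarrow> ('e \<Rightarrow> 'e \<Rightarrow> 'e) \<Rightarrow> bool" where
  "integrable_on_open U J \<longleftrightarrow>
     (\<forall>X Y. smooth_on U X \<longrightarrow> smooth_on U Y \<longrightarrow> (\<forall>p\<in>U. nijenhuis J X Y p = 0))"

definition kahler_on ::
  "'e::real_normed_vector set \<Rightarrow> ('e \<Rightarrow> 'e \<Rightarrow> 'e \<Rightarrow> real) \<Rightarrow> ('e \<Rightarrow> 'e \<Rightarrow> 'e) \<Rightarrow> bool" where
  "kahler_on U G J \<longleftrightarrow> hermitian_on U G J \<and>
     closed_form_on U (\<lambda>p \<xi> \<eta>. G p \<xi> (J p \<eta>)) \<and> integrable_on_open U J"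


section \<open>The warped product\<close>

text \<open>The tangent bundle of the product is identified with the product of the tangent bundles, and
  the index set \<open>1, \<dots>, n + m\<close> is the sum type \<open>'n + 'm\<close>.\<close>

definition warped_product :: "('p \<times> ('p, 'n) tvec \<Rightarrow> real) \<Rightarrow> ('p \<Rightarrow> real) \<Rightarrow>
    ('q \<times> ('q, 'm) tvec \<Rightarrow> real) \<Rightarrow> ('p \<times> ('p, 'n) tvec) \<times> ('q \<times> ('q, 'm) tvec) \<Rightarrow> real" where
  "warped_product F\<^sub>1 f F\<^sub>2 = (\<lambda>(z, w). sqrt ((F\<^sub>1 z)\<^sup>2 + (f (fst z))\<^sup>2 * (F\<^sub>2 w)\<^sup>2))"

definition vfst :: "real ^ ('n::finite + 'm::finite) \<Rightarrow> real ^ 'n" where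
  "vfst x = (\<chi> i. x $ Inl i)"

definition vsnd :: "real ^ ('n::finite + 'm::finite) \<Rightarrow> real ^ 'm" where
  "vsnd x = (\<chi> j. x $ Inr j)"

definition prod_of_coords :: "('p, 'n::finite) chart set \<Rightarrow> ('q, 'm::finite) chart set \<Rightarrow>
    ('p, 'n) chart \<Rightarrow> ('q, 'm) chart \<Rightarrow> ('n + 'm) pt \<Rightarrow>
    ('p \<times> ('p, 'n) tvec) \<times> ('q \<times> ('q, 'm) tvec)" where
  "prod_of_coords \<A>\<^sub>1 \<A>\<^sub>2 c\<^sub>1 c\<^sub>2 = (\<lambda>(x, y).
     (of_coords \<A>\<^sub>1 c\<^sub>1 (vfst x, vfst y), of_coords \<A>\<^sub>2 c\<^sub>2 (vsnd x, vsnd y)))"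

definition prod_slit_coords :: "('p, 'n::finite) chart \<Rightarrow> ('q, 'm::finite) chart \<Rightarrow> ('n + 'm) pt set" where
  "prod_slit_coords c\<^sub>1 c\<^sub>2 =
     {(x, y). (vfst x, vfst y) \<in> slit_coords c\<^sub>1 \<and> (vsnd x, vsnd y) \<in> slit_coords c\<^sub>2}"

text \<open>Tensor fields on the product of the slit bundles are given by their expressions in all
  induced charts; they have one of the pointwise or differential properties above if their
  expressions in all of these charts, which cover the product, have it.\<close>

definition riemannian_bundle :: "('p, 'n::finite) chart set \<Rightarrow> ('q, 'm::finite) chart set \<Rightarrow>
    (('p, 'n) chart \<Rightarrow> ('q, 'm) chart \<Rightarrow> ('n + 'm) pt \<Rightarrow> ('n + 'm) pt \<Rightarrow> ('n + 'm) pt \<Rightarrow> real) \<Rightarrow> bool" where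
  "riemannian_bundle \<A>\<^sub>1 \<A>\<^sub>2 G \<longleftrightarrow>
     (\<forall>c\<^sub>1\<in>\<A>\<^sub>1. \<forall>c\<^sub>2\<in>\<A>\<^sub>2. riemannian_on (prod_slit_coords c\<^sub>1 c\<^sub>2) (G c\<^sub>1 c\<^sub>2))"

definition kahler_bundle :: "('p, 'n::finite) chart set \<Rightarrow> ('q, 'm::finite) chart set \<Rightarrow>
    (('p, 'n) chart \<Rightarrow> ('q, 'm) chart \<Rightarrow> ('n + 'm) pt \<Rightarrow> ('n + 'm) pt \<Rightarrow> ('n + 'm) pt \<Rightarrow> real) \<Rightarrow>
    (('p, 'n) chart \<Rightarrow> ('q, 'm) chart \<Rightarrow> ('n + 'm) pt \<Rightarrow> ('n + 'm) pt \<Rightarrow> ('n + 'm) pt) \<Rightarrow> bool" where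
  "kahler_bundle \<A>\<^sub>1 \<A>\<^sub>2 G J \<longleftrightarrow>
     (\<forall>c\<^sub>1\<in>\<A>\<^sub>1. \<forall>c\<^sub>2\<in>\<A>\<^sub>2. kahler_on (prod_slit_coords c\<^sub>1 c\<^sub>2) (G c\<^sub>1 c\<^sub>2) (J c\<^sub>1 c\<^sub>2))"

end

theory Submission
  imports Defs
begin

text \<open>
  The fundamental form is \<open>\<Omega> = - d(E\<^sub>a dx\<^sup>a)\<close>, where \<open>E = F\<^sup>2 / 2\<close> and \<open>E\<^sub>a\<close> is its derivative in the
  direction of \<open>y\<^sup>a\<close>: for the horizontal distribution of the spray, the antisymmetric part of
  \<open>g\<^sub>a\<^sub>b B\<^sup>b\<^sub>c\<close> is that of the derivative of \<open>E\<^sub>a\<close> in the direction of \<open>x\<^sup>c\<close>. As \<open>P\<close> and \<open>Q\<close> are inverse to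
  each other (by homogeneity, \<open>y\<^sub>a y\<^sup>a = F\<^sup>2\<close>), \<open>J\<^sup>2 = - 1\<close>, the metric is Hermitian and \<open>\<Omega>\<close> is
  closed in all cases, so that only integrability matters. The Nijenhuis tensor satisfies
  \<open>N(J X, Y) = - J N(X, Y)\<close> and therefore vanishes if it vanishes on the horizontal frame, where it
  is the sum of a vertical vector, whose components are the left-hand sides of the first equations, and of
  the image under \<open>J\<close> of a vertical vector made of the left-hand sides of the second equations.
\<close>

section \<open>Calculus of smooth functions\<close>

text \<open>The warped product enters through \<open>F^2\<close> alone: in a pair of charts
  \<open>F^2 = F_1^2 + f^2 F_2^2\<close> is smooth, homogeneous of degree two in y, and has a
  positive definite vertical Hessian. Besides the conditions on A, B and \<tau>, the locale
  \<open>oproiu_chart\<close> asks exactly this of F, on an open set away from y = 0 that is stable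
  under positive scaling of y. The square root is therefore never differentiated. A, B and \<tau>
  disappear from the fundamental form because each half of \<open>G(X, J Y)\<close> contracts one of
  P and Q with its own inverse and leaves g. Integrability quantifies over all smooth vector fields,
  while the equations concern a frame only. The gap is closed by tensoriality: the Nijenhuis bracket
  is rewritten in terms of the first derivative of J, with the flat coordinate space in the role of
  a connection. Smoothness is given by iterated directional derivatives, so closure under the
  algebraic operations and the symmetry of second derivatives have to be drawn from that
  definition.\<close>

lemma frechet_derivative_cong_open:
  assumes "open S" "x \<in> S" "\<And>y. y \<in> S \<Longrightarrow> f y = g y"
  shows "frechet_derivative f (at x) = frechet_derivative g (at x)"
proof -
  \<comment> \<open>\<open>frechet_derivative\<close> is a choice among the derivatives at
    \<open>x\<close>. Both functions have the same, possibly empty, set of them, so the choices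
    coincide even where neither function is differentiable.\<close>
  have "(f has_derivative D) (at x) \<longleftrightarrow> (g has_derivative D) (at x)" for D
    using has_derivative_transform_within_open[OF _ assms(1,2)] assms(3) by metis
  then show ?thesis
    unfolding frechet_derivative_def by simp
qed

lemma frechet_derivative_eqI:
  "(f has_derivative f') (at x) \<Longrightarrow> frechet_derivative f (at x) v = f' v"
  by (metis frechet_derivative_at)

lemma has_frechet_derivative:
  "f differentiable (at x) \<Longrightarrow> (f has_derivative frechet_derivative f (at x)) (at x)"
  by (simp add: frechet_derivative_works)

lemma differentiable_cong_open:
  assumes "open S" "x \<in> S" "\<And>y. y \<in> S \<Longrightarrow> f y = g y"
  shows "f differentiable (at x) \<longleftrightarrow> g differentiable (at x)"
  using has_derivative_transform_within_open[OF _ assms(1,2)] assms(3)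
  unfolding differentiable_def by metis

section \<open>Closure properties of C^k functions\<close>

lemma Ck_on_cong:
  assumes "open S" "\<And>x. x \<in> S \<Longrightarrow> f x = g x"
  shows "Ck_on k S f \<longleftrightarrow> Ck_on k S g"
  using assms(2)
proof (induction k arbitrary: f g)
  case 0
  then show ?case by (simp cong: continuous_on_cong)
next
  case (Suc k)
  have "frechet_derivative f (at x) = frechet_derivative g (at x)" if "x \<in> S" for x
    using frechet_derivative_cong_open[OF assms(1) that] Suc.prems by blast
  then have "Ck_on k S (\<lambda>x. frechet_derivative f (at x) v) \<longleftrightarrow>
      Ck_on k S (\<lambda>x. frechet_derivative g (at x) v)" for v
    by (intro Suc.IH) simp
  moreover have "f differentiable (at x) \<longleftrightarrow> g differentiable (at x)" if "x \<in> S" for x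
    using differentiable_cong_open[OF assms(1) that] Suc.prems by blast
  ultimately show ?case
    by simp
qed

text \<open>The recursion in \<open>Ck_on\<close> speaks of \<open>frechet_derivative\<close>. Here
  a derivative \<open>f'\<close> known in closed form takes its place, which turns the closure
  proofs below into inductions over the rules of differentiation.\<close>

lemma Ck_on_SucI:
  assumes "open S"
    and "\<And>x. x \<in> S \<Longrightarrow> (f has_derivative f' x) (at x)"
    and "\<And>v. Ck_on k S (\<lambda>x. f' x v)"
  shows "Ck_on (Suc k) S f"
proof -
  have "Ck_on k S (\<lambda>x. frechet_derivative f (at x) v)" for v
    using Ck_on_cong[OF assms(1), of "\<lambda>x. frechet_derivative f (at x) v" "\<lambda>x. f' x v"] assms(2,3)
    by (simp add: frechet_derivative_eqI)
  then show ?thesis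
    using assms(2) by (auto simp: differentiable_def)
qed

lemma Ck_on_Suc_imp: "Ck_on (Suc k) S f \<Longrightarrow> Ck_on k S f"
proof (induction k arbitrary: f)
  case 0
  then show ?case
    by (auto intro!: continuous_at_imp_continuous_on differentiable_imp_continuous_within)
qed auto

lemma Ck_on_Suc_has_derivative:
  "Ck_on (Suc k) S f \<Longrightarrow> x \<in> S \<Longrightarrow> (f has_derivative frechet_derivative f (at x)) (at x)"
  by (simp add: has_frechet_derivative)

lemma Ck_on_const: "open S \<Longrightarrow> Ck_on k S (\<lambda>x. c)"
proof (induction k arbitrary: c)
  case (Suc k)
  show ?case
    by (rule Ck_on_SucI[OF Suc.prems has_derivative_const]) (rule Suc.IH[OF Suc.prems])
qed simp

lemma Ck_on_bounded_linear:
  assumes "open S" "bounded_linear f"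
  shows "Ck_on k S f"
proof (cases k)
  case 0
  then show ?thesis
    by (simp add: assms(2) linear_continuous_on)
next
  case (Suc j)
  show ?thesis
    unfolding Suc
    by (rule Ck_on_SucI[OF assms(1) bounded_linear_imp_has_derivative[OF assms(2)]])
      (rule Ck_on_const[OF assms(1)])
qed

lemma Ck_on_add:
  assumes "open S"
  shows "Ck_on k S f \<Longrightarrow> Ck_on k S g \<Longrightarrow> Ck_on k S (\<lambda>x. f x + g x)"
proof (induction k arbitrary: f g)
  case 0
  then show ?case by (simp add: continuous_on_add)
next
  case (Suc k)
  show ?case
  proof (rule Ck_on_SucI[OF assms])
    show "((\<lambda>x. f x + g x) has_derivative
        (\<lambda>v. frechet_derivative f (at x) v + frechet_derivative g (at x) v)) (at x)"
      if "x \<in> S" for x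
      using Suc.prems that by (auto intro!: has_derivative_add has_frechet_derivative)
    show "Ck_on k S (\<lambda>x. frechet_derivative f (at x) v + frechet_derivative g (at x) v)" for v
      using Suc.prems by (intro Suc.IH) auto
  qed
qed

lemma Ck_on_mult:
  fixes f g :: "'e::real_normed_vector \<Rightarrow> real"
  assumes "open S"
  shows "Ck_on k S f \<Longrightarrow> Ck_on k S g \<Longrightarrow> Ck_on k S (\<lambda>x. f x * g x)"
proof (induction k arbitrary: f g)
  case 0
  then show ?case by (simp add: continuous_on_mult)
next
  case (Suc k)
  show ?case
  proof (rule Ck_on_SucI[OF assms])
    show "((\<lambda>x. f x * g x) has_derivative
        (\<lambda>v. f x * frechet_derivative g (at x) v + frechet_derivative f (at x) v * g x)) (at x)"
      if "x \<in> S" for x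
      using Suc.prems that by (auto intro!: has_derivative_mult has_frechet_derivative)
    \<comment> \<open>The product rule keeps one factor undifferentiated; it is of class k + 1 and
      has to be lowered to class k by \<open>Ck_on_Suc_imp\<close>.\<close>
    show "Ck_on k S (\<lambda>x. f x * frechet_derivative g (at x) v + frechet_derivative f (at x) v * g x)"
      for v
      using Suc.prems Ck_on_Suc_imp[OF Suc.prems(1)] Ck_on_Suc_imp[OF Suc.prems(2)]
      by (intro Ck_on_add[OF assms] Suc.IH) auto
  qed
qed

text \<open>The derivative contains the inverse itself, so the induction hypothesis is used for the
  same function one order lower, and \<open>f\<close> stays fixed in the induction.\<close>

lemma Ck_on_inverse:
  fixes f :: "'e::real_normed_vector \<Rightarrow> real"
  assumes "open S" "\<And>x. x \<in> S \<Longrightarrow> f x \<noteq> 0"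
  shows "Ck_on k S f \<Longrightarrow> Ck_on k S (\<lambda>x. inverse (f x))"
proof (induction k)
  case 0
  then show ?case using assms(2) by (simp add: continuous_on_inverse)
next
  case (Suc k)
  show ?case
  proof (rule Ck_on_SucI[OF assms(1)])
    show "((\<lambda>x. inverse (f x)) has_derivative
        (\<lambda>v. - 1 * (inverse (f x) * frechet_derivative f (at x) v * inverse (f x)))) (at x)"
      if "x \<in> S" for x
      using Deriv.has_derivative_inverse[of f x, OF assms(2)[OF that] Ck_on_Suc_has_derivative[OF Suc.prems that]]
      by simp
    show "Ck_on k S (\<lambda>x. - 1 * (inverse (f x) * frechet_derivative f (at x) v * inverse (f x)))" for v
      using Suc.prems Suc.IH[OF Ck_on_Suc_imp[OF Suc.prems]]
      by (intro Ck_on_mult[OF assms(1)] Ck_on_const[OF assms(1)]) auto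
  qed
qed

text \<open>As the inner map is linear, the chain rule leaves it in place and differentiates only
  the outer one: the derivative is again a composition with \<open>l\<close>, now of the derivative
  of \<open>f\<close> in the fixed direction \<open>l v\<close>.\<close>

lemma Ck_on_compose_linear:
  assumes "open T" "bounded_linear l" "l ` T \<subseteq> S"
  shows "Ck_on k S f \<Longrightarrow> Ck_on k T (\<lambda>x. f (l x))"
proof (induction k arbitrary: f)
  case 0
  then show ?case
    using continuous_on_compose2[of S f T l] assms(2,3) linear_continuous_on by auto
next
  case (Suc k)
  show ?case
  proof (rule Ck_on_SucI[OF assms(1)])
    show "((\<lambda>x. f (l x)) has_derivative (\<lambda>v. frechet_derivative f (at (l x)) (l v))) (at x)"
      if "x \<in> T" for x
      using that assms(3) Suc.prems
      by (intro has_derivative_compose[OF bounded_linear_imp_has_derivative[OF assms(2)]]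
          has_frechet_derivative) auto
    show "Ck_on k T (\<lambda>x. frechet_derivative f (at (l x)) (l v))" for v
      using Suc.IH[of "\<lambda>x. frechet_derivative f (at x) (l v)"] Suc.prems by simp
  qed
qed

lemma Ck_on_compose_real:
  fixes h :: "'e::real_normed_vector \<Rightarrow> real" and f :: "real \<Rightarrow> real"
  assumes "open S" "h ` S \<subseteq> T"
  shows "Ck_on k T f \<Longrightarrow> Ck_on k S h \<Longrightarrow> Ck_on k S (\<lambda>x. f (h x))"
proof (induction k arbitrary: f)
  case 0
  then show ?case
    using continuous_on_compose2[of T f S h] assms(2) by auto
next
  case (Suc k)
  show ?case
  proof (rule Ck_on_SucI[OF assms(1)])
    show "((\<lambda>x. f (h x)) has_derivative
        (\<lambda>v. frechet_derivative f (at (h x)) 1 * frechet_derivative h (at x) v)) (at x)"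
      if "x \<in> S" for x
    proof -
      have D: "(f has_derivative frechet_derivative f (at (h x))) (at (h x))"
        using that assms(2) Suc.prems by (auto intro!: has_frechet_derivative)
      \<comment> \<open>A linear map on the reals is multiplication by its value at 1. This makes
        the chain rule a product of two functions, to which \<open>Ck_on_mult\<close>
        applies.\<close>
      have "frechet_derivative f (at (h x)) = (\<lambda>r. frechet_derivative f (at (h x)) 1 * r)"
      proof
        show "frechet_derivative f (at (h x)) r = frechet_derivative f (at (h x)) 1 * r" for r
          using linear_scale[OF has_derivative_linear[OF D], of r 1] by simp
      qed
      with D have "(f has_derivative (\<lambda>r. frechet_derivative f (at (h x)) 1 * r)) (at (h x))"
        by simp
      then show ?thesis
        by (rule has_derivative_compose[OF Ck_on_Suc_has_derivative[OF Suc.prems(2) that]])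
    qed
    show "Ck_on k S (\<lambda>x. frechet_derivative f (at (h x)) 1 * frechet_derivative h (at x) v)" for v
      using Suc.IH[of "\<lambda>x. frechet_derivative f (at x) 1"] Suc.prems Ck_on_Suc_imp[OF Suc.prems(2)]
      by (intro Ck_on_mult[OF assms(1)]) auto
  qed
qed

section \<open>The same closure properties for smooth functions\<close>

lemma smooth_on_cong:
  "open S \<Longrightarrow> (\<And>x. x \<in> S \<Longrightarrow> f x = g x) \<Longrightarrow> smooth_on S f \<longleftrightarrow> smooth_on S g"
  unfolding smooth_on_def using Ck_on_cong by blast

lemma smooth_on_differentiable: "smooth_on S f \<Longrightarrow> x \<in> S \<Longrightarrow> f differentiable (at x)"
  unfolding smooth_on_def by (metis Ck_on.simps(2))

lemma smooth_on_has_derivative: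
  "smooth_on S f \<Longrightarrow> x \<in> S \<Longrightarrow> (f has_derivative frechet_derivative f (at x)) (at x)"
  by (simp add: has_frechet_derivative smooth_on_differentiable)

lemma smooth_on_deriv: "smooth_on S f \<Longrightarrow> smooth_on S (\<lambda>x. frechet_derivative f (at x) v)"
  unfolding smooth_on_def by (metis Ck_on.simps(2))

lemma smooth_on_continuous: "smooth_on S f \<Longrightarrow> continuous_on S f"
  unfolding smooth_on_def by (metis Ck_on.simps(1))

lemma smooth_on_const: "open S \<Longrightarrow> smooth_on S (\<lambda>x. c)"
  by (simp add: smooth_on_def Ck_on_const)

lemma smooth_on_bounded_linear: "open S \<Longrightarrow> bounded_linear f \<Longrightarrow> smooth_on S f"
  by (simp add: smooth_on_def Ck_on_bounded_linear)

lemma smooth_on_add: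
  "open S \<Longrightarrow> smooth_on S f \<Longrightarrow> smooth_on S g \<Longrightarrow> smooth_on S (\<lambda>x. f x + g x)"
  by (simp add: smooth_on_def Ck_on_add)

lemma smooth_on_mult:
  fixes f g :: "'e::real_normed_vector \<Rightarrow> real"
  shows "open S \<Longrightarrow> smooth_on S f \<Longrightarrow> smooth_on S g \<Longrightarrow> smooth_on S (\<lambda>x. f x * g x)"
  by (simp add: smooth_on_def Ck_on_mult)

lemma smooth_on_diff:
  fixes f g :: "'e::real_normed_vector \<Rightarrow> real"
  assumes "open S" "smooth_on S f" "smooth_on S g"
  shows "smooth_on S (\<lambda>x. f x - g x)"
  using smooth_on_add[OF assms(1,2) smooth_on_mult[OF assms(1) smooth_on_const[OF assms(1), of "-1"] assms(3)]]
  by simp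

lemma smooth_on_divide:
  fixes f g :: "'e::real_normed_vector \<Rightarrow> real"
  assumes "open S" "smooth_on S f" "smooth_on S g" "\<And>x. x \<in> S \<Longrightarrow> g x \<noteq> 0"
  shows "smooth_on S (\<lambda>x. f x / g x)"
  using smooth_on_mult[OF assms(1,2)] assms Ck_on_inverse[of S g]
  by (simp add: divide_inverse smooth_on_def)

lemma smooth_on_power2:
  fixes f :: "'e::real_normed_vector \<Rightarrow> real"
  shows "open S \<Longrightarrow> smooth_on S f \<Longrightarrow> smooth_on S (\<lambda>x. (f x)\<^sup>2)"
  by (simp add: power2_eq_square smooth_on_mult)

lemma smooth_on_sum:
  assumes "open S" "\<And>i. i \<in> I \<Longrightarrow> smooth_on S (f i)"
  shows "smooth_on S (\<lambda>x. \<Sum>i\<in>I. f i x)"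
  using assms(2) by (induction I rule: infinite_finite_induct)
    (auto intro: smooth_on_const smooth_on_add assms(1))

lemma smooth_on_prod:
  fixes f :: "'i \<Rightarrow> 'e::real_normed_vector \<Rightarrow> real"
  assumes "open S" "\<And>i. i \<in> I \<Longrightarrow> smooth_on S (f i)"
  shows "smooth_on S (\<lambda>x. \<Prod>i\<in>I. f i x)"
  using assms(2) by (induction I rule: infinite_finite_induct)
    (auto intro: smooth_on_const smooth_on_mult assms(1))

lemma smooth_on_compose_linear:
  assumes "open T" "bounded_linear l" "l ` T \<subseteq> S" "smooth_on S f"
  shows "smooth_on T (\<lambda>x. f (l x))"
  unfolding smooth_on_def
proof
  show "Ck_on k T (\<lambda>x. f (l x))" for k
    using Ck_on_compose_linear[OF assms(1-3), of k f] assms(4) by (simp add: smooth_on_def)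
qed

lemma smooth_on_compose_real:
  fixes h :: "'e::real_normed_vector \<Rightarrow> real" and f :: "real \<Rightarrow> real"
  assumes "open S" "h ` S \<subseteq> T" "smooth_on T f" "smooth_on S h"
  shows "smooth_on S (\<lambda>x. f (h x))"
  using assms(3,4) Ck_on_compose_real[OF assms(1,2)] by (simp add: smooth_on_def)

section \<open>Smoothness of inverse matrices\<close>

lemma smooth_on_det:
  fixes M :: "'e::real_normed_vector \<Rightarrow> real ^ 'i ^ 'i::finite"
  assumes "open S" "\<And>i j. smooth_on S (\<lambda>x. M x $ i $ j)"
  shows "smooth_on S (\<lambda>x. det (M x))"
  unfolding det_def
  by (intro smooth_on_sum smooth_on_mult smooth_on_prod smooth_on_const assms)

lemma matrix_inv_inverse:
  fixes M :: "real ^ 'i ^ 'i::finite"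
  assumes "det M \<noteq> 0"
  shows "M ** matrix_inv M = mat 1" "matrix_inv M ** M = mat 1"
proof -
  have "\<exists>M'. M ** M' = mat 1 \<and> M' ** M = mat 1"
    using assms by (simp add: invertible_det_nz[symmetric] invertible_def)
  from someI_ex[OF this, folded matrix_inv_def]
  show "M ** matrix_inv M = mat 1" "matrix_inv M ** M = mat 1"
    by blast+
qed

text \<open>Column b of the inverse solves a linear system with right-hand side
  \<open>axis b 1\<close>. Cramer's rule presents its entries as quotients of polynomials in the
  entries of \<open>M\<close>, and in this form smoothness passes to the inverse.\<close>

lemma matrix_inv_cramer:
  fixes M :: "real ^ 'i ^ 'i::finite"
  assumes "det M \<noteq> 0"
  shows "matrix_inv M $ a $ b = det (\<chi> i j. if j = a then axis b 1 $ i else M $ i $ j) / det M"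
proof -
  have "M *v (matrix_inv M *v axis b 1) = axis b 1"
    using assms by (simp add: matrix_vector_mul_assoc matrix_inv_inverse)
  then have "matrix_inv M *v axis b 1 =
      (\<chi> k. det (\<chi> i j. if j = k then axis b 1 $ i else M $ i $ j) / det M)"
    using cramer[OF assms] by blast
  then have "(matrix_inv M *v axis b 1) $ a =
      det (\<chi> i j. if j = a then axis b 1 $ i else M $ i $ j) / det M"
    by simp
  then show ?thesis
    by (simp add: matrix_vector_mult_basis column_def)
qed

lemma smooth_on_matrix_inv:
  fixes M :: "'e::real_normed_vector \<Rightarrow> real ^ 'i ^ 'i::finite"
  assumes "open S" "\<And>i j. smooth_on S (\<lambda>x. M x $ i $ j)" "\<And>x. x \<in> S \<Longrightarrow> det (M x) \<noteq> 0"
  shows "smooth_on S (\<lambda>x. matrix_inv (M x) $ a $ b)"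
proof -
  have "smooth_on S (\<lambda>x. (if j = a then axis b 1 $ i else M x $ i $ j) :: real)" for i j
    by (cases "j = a") (auto intro: smooth_on_const assms)
  then have "smooth_on S (\<lambda>x. det (\<chi> i j. if j = a then axis b 1 $ i else M x $ i $ j) / det (M x))"
    by (intro smooth_on_divide smooth_on_det assms) simp_all
  then show ?thesis
    by (rule iffD1[OF smooth_on_cong[OF assms(1)], rotated]) (simp add: matrix_inv_cramer assms(3))
qed

section \<open>Symmetry of second derivatives\<close>

lemma has_real_derivative_along_line:
  fixes f :: "'e::real_normed_vector \<Rightarrow> real"
  assumes "f differentiable (at (x + t *\<^sub>R v))"
  shows "((\<lambda>s. f (x + s *\<^sub>R v)) has_real_derivative frechet_derivative f (at (x + t *\<^sub>R v)) v) (at t)"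
proof -
  have D: "(f has_derivative frechet_derivative f (at (x + t *\<^sub>R v))) (at (x + t *\<^sub>R v))"
    using assms by (rule has_frechet_derivative)
  have "((\<lambda>s. x + s *\<^sub>R v) has_derivative (\<lambda>s. s *\<^sub>R v)) (at t)"
    by (auto intro!: derivative_eq_intros)
  from has_derivative_compose[OF this D] show ?thesis
    using linear_scale[OF has_derivative_linear[OF D]]
    by (simp add: has_field_derivative_def mult.commute[of _ "frechet_derivative f _ v"])
qed

text \<open>Two uses of the mean value theorem: along \<open>u\<close> for the increment of
  \<open>f\<close> under the shift by \<open>h *\<^sub>R v\<close>, then along \<open>v\<close> for
  the derivative of \<open>f\<close> in direction \<open>u\<close>. The left-hand side is symmetric
  in \<open>u\<close> and \<open>v\<close>, which is what makes the formula useful.\<close>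

lemma second_difference_mvt:
  fixes f :: "'e::real_normed_vector \<Rightarrow> real"
  assumes "smooth_on S f" "ball x r \<subseteq> S" "0 < h" "h * norm u + h * norm v < r"
  shows "\<exists>y\<in>ball x r. f (x + h *\<^sub>R u + h *\<^sub>R v) - f (x + h *\<^sub>R u) - f (x + h *\<^sub>R v) + f x
    = h * h * frechet_derivative (\<lambda>z. frechet_derivative f (at z) u) (at y) v"
proof -
  let ?f' = "\<lambda>z. frechet_derivative f (at z) u"
  have in_ball: "x + s *\<^sub>R u + t *\<^sub>R v \<in> ball x r" if "0 \<le> s" "s \<le> h" "0 \<le> t" "t \<le> h" for s t
  proof -
    have "norm (s *\<^sub>R u + t *\<^sub>R v) \<le> s * norm u + t * norm v"
      using that norm_triangle_ineq[of "s *\<^sub>R u" "t *\<^sub>R v"] by simp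
    also have "\<dots> \<le> h * norm u + h * norm v"
      using that by (intro add_mono mult_right_mono) auto
    finally show ?thesis
      using assms(4) by (simp add: dist_norm norm_minus_commute algebra_simps)
  qed
  have diff: "f differentiable (at y)" "?f' differentiable (at y)" if "y \<in> ball x r" for y
    using that assms(1,2) smooth_on_differentiable smooth_on_deriv by blast+
  have "\<exists>s. 0 < s \<and> s < h \<and>
      (f (x + h *\<^sub>R v + h *\<^sub>R u) - f (x + h *\<^sub>R u)) - (f (x + h *\<^sub>R v + 0 *\<^sub>R u) - f (x + 0 *\<^sub>R u))
      = (h - 0) * (?f' (x + h *\<^sub>R v + s *\<^sub>R u) - ?f' (x + s *\<^sub>R u))"
  proof (rule MVT2[OF assms(3)])
    fix s assume s: "0 \<le> s" "s \<le> h"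
    show "((\<lambda>s. f (x + h *\<^sub>R v + s *\<^sub>R u) - f (x + s *\<^sub>R u)) has_real_derivative
        ?f' (x + h *\<^sub>R v + s *\<^sub>R u) - ?f' (x + s *\<^sub>R u)) (at s)"
      using in_ball[OF s, of h] in_ball[OF s, of 0] assms(3)
      by (intro DERIV_diff has_real_derivative_along_line diff) (simp_all add: algebra_simps)
  qed
  then obtain s where s: "0 < s" "s < h" and eq1:
    "(f (x + h *\<^sub>R v + h *\<^sub>R u) - f (x + h *\<^sub>R u)) - (f (x + h *\<^sub>R v + 0 *\<^sub>R u) - f (x + 0 *\<^sub>R u))
      = (h - 0) * (?f' (x + h *\<^sub>R v + s *\<^sub>R u) - ?f' (x + s *\<^sub>R u))"
    by blast
  have "\<exists>t. 0 < t \<and> t < h \<and> ?f' (x + s *\<^sub>R u + h *\<^sub>R v) - ?f' (x + s *\<^sub>R u + 0 *\<^sub>R v)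
      = (h - 0) * frechet_derivative ?f' (at (x + s *\<^sub>R u + t *\<^sub>R v)) v"
    using s by (intro MVT2[OF assms(3)] has_real_derivative_along_line diff in_ball) auto
  then obtain t where t: "0 < t" "t < h" and eq2:
    "?f' (x + s *\<^sub>R u + h *\<^sub>R v) - ?f' (x + s *\<^sub>R u + 0 *\<^sub>R v)
      = (h - 0) * frechet_derivative ?f' (at (x + s *\<^sub>R u + t *\<^sub>R v)) v"
    by blast
  show ?thesis
  proof
    show "x + s *\<^sub>R u + t *\<^sub>R v \<in> ball x r"
      using s t by (intro in_ball) auto
    show "f (x + h *\<^sub>R u + h *\<^sub>R v) - f (x + h *\<^sub>R u) - f (x + h *\<^sub>R v) + f x
        = h * h * frechet_derivative ?f' (at (x + s *\<^sub>R u + t *\<^sub>R v)) v"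
    proof -
      have "x + h *\<^sub>R v + h *\<^sub>R u = x + h *\<^sub>R u + h *\<^sub>R v" "x + h *\<^sub>R v + s *\<^sub>R u = x + s *\<^sub>R u + h *\<^sub>R v"
        by simp_all
      with eq1 eq2 show ?thesis
        by simp
    qed
  qed
qed

text \<open>Schwarz's theorem: one and the same second difference is h^2 times either mixed
  derivative at some point near \<open>x\<close>, and both mixed derivatives are continuous at
  \<open>x\<close>.\<close>

lemma smooth_on_deriv_commute:
  fixes f :: "'e::real_normed_vector \<Rightarrow> real"
  assumes "open S" "x \<in> S" "smooth_on S f"
  shows "frechet_derivative (\<lambda>z. frechet_derivative f (at z) u) (at x) v
    = frechet_derivative (\<lambda>z. frechet_derivative f (at z) v) (at x) u"
    (is "?a x = ?b x")
proof -
  have cont: "isCont ?a x" "isCont ?b x"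
    using smooth_on_continuous[OF smooth_on_deriv[OF smooth_on_deriv[OF assms(3)]]]
      assms(1,2) continuous_on_eq_continuous_at by blast+
  obtain r where r: "0 < r" "ball x r \<subseteq> S"
    using assms(1,2) open_contains_ball by blast
  have "dist (?a x) (?b x) < e" if e: "0 < e" for e
  proof -
    obtain d1 where d1: "0 < d1" "\<And>y. dist y x < d1 \<Longrightarrow> dist (?a y) (?a x) < e / 2"
      using cont(1)[unfolded continuous_at_eps_delta, THEN spec, of "e / 2"] e by auto
    obtain d2 where d2: "0 < d2" "\<And>y. dist y x < d2 \<Longrightarrow> dist (?b y) (?b x) < e / 2"
      using cont(2)[unfolded continuous_at_eps_delta, THEN spec, of "e / 2"] e by auto
    define d where "d = min r (min d1 d2)"
    \<comment> \<open>The summand 1 keeps \<open>c\<close> positive when \<open>u\<close> and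
      \<open>v\<close> both vanish. With h c = d / 2 both increments together stay shorter than
      \<open>d\<close>.\<close>
    define c where "c = norm u + norm v + 1"
    define h where "h = d / (2 * c)"
    have pos: "0 < c"
      by (simp add: c_def add_nonneg_pos)
    have d: "0 < d" "d \<le> r" "d \<le> d1" "d \<le> d2"
      using r d1 d2 by (auto simp: d_def)
    have "h * c = d / 2"
      using pos by (simp add: h_def)
    then have h: "0 < h" and "h * c < d"
      using pos d(1) by (simp_all add: h_def)
    then have hd: "h * norm u + h * norm v < d"
      using h by (simp add: c_def algebra_simps)
    have sub: "ball x d \<subseteq> S"
      using d(2) r(2) by (meson order_trans subset_ball)
    obtain y where y: "y \<in> ball x d" "f (x + h *\<^sub>R u + h *\<^sub>R v) - f (x + h *\<^sub>R u) - f (x + h *\<^sub>R v) + f x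
        = h * h * ?a y"
      using second_difference_mvt[OF assms(3) sub h hd] by blast
    obtain z where z: "z \<in> ball x d" "f (x + h *\<^sub>R v + h *\<^sub>R u) - f (x + h *\<^sub>R v) - f (x + h *\<^sub>R u) + f x
        = h * h * ?b z"
      using second_difference_mvt[OF assms(3) sub h, of v u] hd by auto
    have "h * h * ?a y = h * h * ?b z"
      using y(2) z(2) by (simp add: algebra_simps)
    then have "?a y = ?b z"
      using h by simp
    moreover have "dist (?a y) (?a x) < e / 2" "dist (?b z) (?b x) < e / 2"
      using y(1) z(1) d d1(2)[of y] d2(2)[of z] dist_commute[of x y] dist_commute[of x z]
      by (simp_all only: mem_ball)
    ultimately show ?thesis
      using dist_triangle_half_r[of "?a y" "?a x" e "?b x"] by simp
  qed
  then show ?thesis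
    using less_irrefl[of "dist (?a x) (?b x)"] zero_less_dist_iff[of "?a x" "?b x"] by blast
qed

section \<open>The Nijenhuis tensor\<close>

locale almost_complex_field =
  fixes U :: "'e::euclidean_space set" and J :: "'e \<Rightarrow> 'e \<Rightarrow> 'e"
  assumes open_U: "open U"
    and linear_J: "p \<in> U \<Longrightarrow> linear (J p)"
    and J_J: "p \<in> U \<Longrightarrow> J p (J p v) = - v"
    and differentiable_J: "p \<in> U \<Longrightarrow> (\<lambda>q. J q v) differentiable (at p)"
begin

definition dJ :: "'e \<Rightarrow> 'e \<Rightarrow> 'e \<Rightarrow> 'e" where
  "dJ p u v = frechet_derivative (\<lambda>q. J q v) (at p) u"

text \<open>This is what the bracket expression in \<open>nijenhuis\<close> gives on the constant
  fields \<open>u\<close> and \<open>v\<close>, whose own derivatives vanish.\<close>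

definition nij :: "'e \<Rightarrow> 'e \<Rightarrow> 'e \<Rightarrow> 'e" where
  "nij p u v = dJ p (J p u) v - dJ p (J p v) u + J p (dJ p v u) - J p (dJ p u v)"

lemma J_expand:
  assumes "p \<in> U"
  shows "J p v = (\<Sum>b\<in>Basis. (v \<bullet> b) *\<^sub>R J p b)"
proof -
  have "J p (\<Sum>b\<in>Basis. (v \<bullet> b) *\<^sub>R b) = (\<Sum>b\<in>Basis. (v \<bullet> b) *\<^sub>R J p b)"
    using linear_J[OF assms] by (simp add: linear_sum linear_scale)
  then show ?thesis
    by (simp add: euclidean_representation)
qed

text \<open>\<open>differentiable_J\<close> concerns fixed vectors. Expanding X in the basis, which
  linearity of J permits on \<open>U\<close>, trades the moving argument for finitely many fixed
  ones with differentiable coefficients.\<close>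

lemma J_field_has_derivative_Basis:
  assumes "p \<in> U" "(X has_derivative X') (at p)"
  shows "((\<lambda>q. J q (X q)) has_derivative
    (\<lambda>u. J p (X' u) + (\<Sum>b\<in>Basis. (X p \<bullet> b) *\<^sub>R dJ p u b))) (at p)"
proof -
  have J: "((\<lambda>q. J q b) has_derivative (\<lambda>u. dJ p u b)) (at p)" for b
    unfolding dJ_def using has_frechet_derivative[OF differentiable_J[OF assms(1)]] by simp
  have "((\<lambda>q. \<Sum>b\<in>Basis. (X q \<bullet> b) *\<^sub>R J q b) has_derivative
      (\<lambda>u. \<Sum>b\<in>Basis. (X p \<bullet> b) *\<^sub>R dJ p u b + (X' u \<bullet> b) *\<^sub>R J p b)) (at p)"
    by (intro has_derivative_sum has_derivative_scaleR J has_derivative_inner_left assms(2))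
  moreover have "(\<lambda>u. \<Sum>b\<in>Basis. (X p \<bullet> b) *\<^sub>R dJ p u b + (X' u \<bullet> b) *\<^sub>R J p b)
      = (\<lambda>u. J p (X' u) + (\<Sum>b\<in>Basis. (X p \<bullet> b) *\<^sub>R dJ p u b))"
  proof
    show "(\<Sum>b\<in>Basis. (X p \<bullet> b) *\<^sub>R dJ p u b + (X' u \<bullet> b) *\<^sub>R J p b)
        = J p (X' u) + (\<Sum>b\<in>Basis. (X p \<bullet> b) *\<^sub>R dJ p u b)" for u
      unfolding J_expand[OF assms(1), of "X' u"] by (simp add: sum.distrib)
  qed
  ultimately have "((\<lambda>q. \<Sum>b\<in>Basis. (X q \<bullet> b) *\<^sub>R J q b) has_derivative
      (\<lambda>u. J p (X' u) + (\<Sum>b\<in>Basis. (X p \<bullet> b) *\<^sub>R dJ p u b))) (at p)"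
    by simp
  then show ?thesis
    by (rule has_derivative_transform_within_open[OF _ open_U assms(1)])
      (rule J_expand[symmetric])
qed

text \<open>The previous formula for a constant field; it yields linearity of \<open>dJ\<close> in
  the vector on which J acts.\<close>

lemma dJ_expand:
  assumes "p \<in> U"
  shows "dJ p u v = (\<Sum>b\<in>Basis. (v \<bullet> b) *\<^sub>R dJ p u b)"
  using frechet_derivative_eqI[OF J_field_has_derivative_Basis[OF assms has_derivative_const], of v u]
    linear_0[OF linear_J[OF assms]]
  by (simp add: dJ_def)

lemma J_field_has_derivative:
  assumes "p \<in> U" "(X has_derivative X') (at p)"
  shows "((\<lambda>q. J q (X q)) has_derivative (\<lambda>u. J p (X' u) + dJ p u (X p))) (at p)"
  using J_field_has_derivative_Basis[OF assms] unfolding dJ_expand[OF assms(1), of _ "X p"] .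

lemma linear_dJ:
  assumes "p \<in> U"
  shows "linear (\<lambda>u. dJ p u v)" "linear (dJ p u)"
proof -
  show "linear (\<lambda>u. dJ p u v)"
    unfolding dJ_def
    using has_derivative_linear[OF has_frechet_derivative[OF differentiable_J[OF assms]]] by simp
  have "linear (\<lambda>v. \<Sum>b\<in>Basis. (v \<bullet> b) *\<^sub>R dJ p u b)"
    by (intro linearI) (simp_all add: inner_add_left scaleR_left_distrib sum.distrib scaleR_sum_right)
  moreover have "dJ p u = (\<lambda>v. \<Sum>b\<in>Basis. (v \<bullet> b) *\<^sub>R dJ p u b)"
    using dJ_expand[OF assms] by blast
  ultimately show "linear (dJ p u)"
    by simp
qed

text \<open>Obtained by differentiating \<open>J q (J q v) = - v\<close>, whose right-hand side is
  constant in \<open>q\<close>.\<close>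

lemma dJ_J:
  assumes "p \<in> U"
  shows "dJ p u (J p v) = - J p (dJ p u v)"
proof -
  have "((\<lambda>q. J q v) has_derivative (\<lambda>u. dJ p u v)) (at p)"
    unfolding dJ_def using has_frechet_derivative[OF differentiable_J[OF assms]] by simp
  from J_field_has_derivative[OF assms this]
  have "((\<lambda>q. - v) has_derivative (\<lambda>u. J p (dJ p u v) + dJ p u (J p v))) (at p)"
    by (rule has_derivative_transform_within_open[OF _ open_U assms]) (simp add: J_J)
  from frechet_derivative_eqI[OF this, of u] show ?thesis
    by (simp add: eq_neg_iff_add_eq_0 add.commute)
qed

text \<open>Tensoriality. The derivatives of X and Y occur in the four brackets once bare and once
  under J, or twice under J, and cancel because J squares to -1; only derivatives of J
  survive.\<close>

lemma nijenhuis_eq_nij: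
  assumes "p \<in> U" "X differentiable (at p)" "Y differentiable (at p)"
  shows "nijenhuis J X Y p = nij p (X p) (Y p)"
proof -
  let ?X' = "frechet_derivative X (at p)" and ?Y' = "frechet_derivative Y (at p)"
  have JX: "frechet_derivative (\<lambda>q. J q (X q)) (at p) u = J p (?X' u) + dJ p u (X p)" for u
    by (rule frechet_derivative_eqI[OF J_field_has_derivative[OF assms(1) has_frechet_derivative[OF assms(2)]]])
  have JY: "frechet_derivative (\<lambda>q. J q (Y q)) (at p) u = J p (?Y' u) + dJ p u (Y p)" for u
    by (rule frechet_derivative_eqI[OF J_field_has_derivative[OF assms(1) has_frechet_derivative[OF assms(3)]]])
  show ?thesis
    unfolding nijenhuis_def lie_bracket_def JX JY nij_def
    using linear_J[OF assms(1)] by (simp add: linear_add linear_diff J_J[OF assms(1)])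
qed

lemma nij_commute: "nij p v u = - nij p u v"
  by (simp add: nij_def)

lemma linear_nij:
  assumes "p \<in> U"
  shows "linear (\<lambda>u. nij p u v)"
  unfolding nij_def
  by (intro linearI) (simp_all add: linear_add[OF linear_dJ(1)[OF assms]] linear_add[OF linear_dJ(2)[OF assms]]
      linear_add[OF linear_J[OF assms]] linear_scale[OF linear_dJ(1)[OF assms]]
      linear_scale[OF linear_dJ(2)[OF assms]] linear_scale[OF linear_J[OF assms]] algebra_simps)

text \<open>J anticommutes with each \<open>dJ p u\<close>, so pulling J out of the vector slot
  costs a sign, while J in the direction slot exchanges the terms with and without an outer
  J.\<close>

lemma nij_J_left:
  assumes "p \<in> U"
  shows "nij p (J p u) v = - J p (nij p u v)"
  unfolding nij_def
  using linear_J[OF assms]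
  by (simp add: J_J[OF assms] dJ_J[OF assms] linear_neg[OF linear_dJ(1)[OF assms]]
      linear_neg[OF linear_J[OF assms]] linear_add linear_diff)

text \<open>With the second argument in \<open>H\<close>, \<open>nij_J_left\<close> extends
  vanishing to J \<open>H\<close> in the first slot and linearity to everything. Antisymmetry
  exchanges the slots, and the same argument is run once more.\<close>

lemma nij_eq_0_of_frame:
  assumes p: "p \<in> U" and span: "span (H \<union> J p ` H) = UNIV"
    and H: "\<And>u v. u \<in> H \<Longrightarrow> v \<in> H \<Longrightarrow> nij p u v = 0"
  shows "nij p u v = 0"
proof -
  have J0: "J p 0 = 0"
    by (rule linear_0[OF linear_J[OF p]])
  have 1: "nij p u v = 0" if "v \<in> H" for u v
  proof (rule linear_eq_0_on_span[OF linear_nij[OF p], of "H \<union> J p ` H"])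
    show "u \<in> span (H \<union> J p ` H)"
      using span by simp
    show "nij p w v = 0" if "w \<in> H \<union> J p ` H" for w
      using that H \<open>v \<in> H\<close> by (auto simp: nij_J_left[OF p] J0)
  qed
  have 2: "nij p u v = 0" if "u \<in> H" for u v
    using 1[OF that, of v] nij_commute[of p u v] by simp
  show ?thesis
  proof (rule linear_eq_0_on_span[OF linear_nij[OF p], of "H \<union> J p ` H"])
    show "u \<in> span (H \<union> J p ` H)"
      using span by simp
    show "nij p w v = 0" if "w \<in> H \<union> J p ` H" for w
      using that 2 by (auto simp: nij_J_left[OF p] J0)
  qed
qed

lemma integrable_on_open_iff_nij:
  "integrable_on_open U J \<longleftrightarrow> (\<forall>p\<in>U. \<forall>u v. nij p u v = 0)"
proof
  assume int: "integrable_on_open U J"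
  have "nij p u v = 0" if "p \<in> U" for p u v
    \<comment> \<open>Constant fields are smooth and attain every prescribed pair of values at
      \<open>p\<close>.\<close>
    using int[unfolded integrable_on_open_def, rule_format, OF smooth_on_const[OF open_U] smooth_on_const[OF open_U] that]
      nijenhuis_eq_nij[OF that, of "\<lambda>q. u" "\<lambda>q. v"] by simp
  then show "\<forall>p\<in>U. \<forall>u v. nij p u v = 0"
    by blast
next
  assume "\<forall>p\<in>U. \<forall>u v. nij p u v = 0"
  then show "integrable_on_open U J"
    unfolding integrable_on_open_def using nijenhuis_eq_nij smooth_on_differentiable by metis
qed

lemma integrable_on_open_iff_frame:
  assumes "\<And>p a. p \<in> U \<Longrightarrow> h a differentiable (at p)"
    and "\<And>p. p \<in> U \<Longrightarrow> span (range (\<lambda>a. h a p) \<union> range (\<lambda>a. J p (h a p))) = UNIV"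
  shows "integrable_on_open U J \<longleftrightarrow> (\<forall>p\<in>U. \<forall>a b. nijenhuis J (h a) (h b) p = 0)"
proof -
  have "(\<forall>u v. nij p u v = 0) \<longleftrightarrow> (\<forall>a b. nij p (h a p) (h b p) = 0)" if "p \<in> U" for p
  proof
    assume H: "\<forall>a b. nij p (h a p) (h b p) = 0"
    have "span (range (\<lambda>a. h a p) \<union> J p ` range (\<lambda>a. h a p)) = UNIV"
      using assms(2)[OF that] by (simp add: image_image)
    with H show "\<forall>u v. nij p u v = 0"
      using nij_eq_0_of_frame[OF that, of "range (\<lambda>a. h a p)"] by blast
  qed blast
  then show ?thesis
    unfolding integrable_on_open_iff_nij by (simp add: nijenhuis_eq_nij assms(1))
qed

end

section \<open>Coordinate expressions\<close>

lemma sum_axis: "(\<Sum>a\<in>UNIV. u $ a *\<^sub>R axis a (1::real)) = (u :: real ^ 'i::finite)"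
  by (simp add: vec_eq_iff axis_def if_distrib cong: if_cong)

lemma pt_expand:
  "\<xi> = (\<Sum>a\<in>UNIV. fst \<xi> $ a *\<^sub>R (axis a 1, 0)) + (\<Sum>a\<in>UNIV. snd \<xi> $ a *\<^sub>R (0, axis a 1))"
  for \<xi> :: "'i::finite pt"
  by (intro prod_eqI) (simp_all add: fst_sum snd_sum sum_axis)

lemma frechet_derivative_pt:
  assumes "h differentiable (at p)"
  shows "frechet_derivative h (at p) \<xi> =
    (\<Sum>a\<in>UNIV. fst \<xi> $ a * dx a h p) + (\<Sum>a\<in>UNIV. snd \<xi> $ a * dy a h p)"
proof -
  have lin: "linear (frechet_derivative h (at p))"
    by (rule has_derivative_linear[OF has_frechet_derivative[OF assms]])
  show ?thesis
    by (subst pt_expand[of \<xi>]) (simp add: linear_add[OF lin] linear_sum[OF lin] linear_scale[OF lin] dx_def dy_def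
        del: scaleR_Pair)
qed

lemma frechet_derivative_vertical:
  assumes "h differentiable (at p)"
  shows "frechet_derivative h (at p) (0, w) = (\<Sum>a\<in>UNIV. w $ a * dy a h p)"
  using frechet_derivative_pt[OF assms, of "(0, w)"] by simp

lemma smooth_on_dx: "smooth_on S h \<Longrightarrow> smooth_on S (dx a h)"
  unfolding dx_def[abs_def] by (rule smooth_on_deriv)

lemma smooth_on_dy: "smooth_on S h \<Longrightarrow> smooth_on S (dy a h)"
  unfolding dy_def[abs_def] by (rule smooth_on_deriv)

lemma dy_dy_commute:
  assumes "open S" "p \<in> S" "smooth_on S h"
  shows "dy a (dy b h) p = dy b (dy a h) p"
  unfolding dy_def by (rule smooth_on_deriv_commute[OF assms])

lemma dy_dx_commute:
  assumes "open S" "p \<in> S" "smooth_on S h"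
  shows "dy a (dx b h) p = dx b (dy a h) p"
  unfolding dy_def dx_def by (rule smooth_on_deriv_commute[OF assms])

lemma dy_cong:
  "open S \<Longrightarrow> p \<in> S \<Longrightarrow> (\<And>q. q \<in> S \<Longrightarrow> h q = k q) \<Longrightarrow> dy a h p = dy a k p"
  unfolding dy_def using frechet_derivative_cong_open[of S p h k] by simp

lemma dy_diff:
  "h differentiable (at p) \<Longrightarrow> k differentiable (at p) \<Longrightarrow> dy a (\<lambda>q. h q - k q) p = dy a h p - dy a k p"
  using frechet_derivative_eqI[OF has_derivative_diff[OF has_frechet_derivative has_frechet_derivative]]
  unfolding dy_def by blast

lemma dy_mult:
  "h differentiable (at p) \<Longrightarrow> k differentiable (at p) \<Longrightarrow>
    dy a (\<lambda>q. h q * k q) p = h p * dy a k p + dy a h p * k p"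
  using frechet_derivative_eqI[OF has_derivative_mult[OF has_frechet_derivative has_frechet_derivative]]
  unfolding dy_def by blast

lemma dy_cmult: "h differentiable (at p) \<Longrightarrow> dy a (\<lambda>q. c * h q) p = c * dy a h p"
  using frechet_derivative_eqI[OF has_derivative_mult_right[OF has_frechet_derivative]]
  unfolding dy_def by blast

lemma dx_cmult: "h differentiable (at p) \<Longrightarrow> dx a (\<lambda>q. c * h q) p = c * dx a h p"
  using frechet_derivative_eqI[OF has_derivative_mult_right[OF has_frechet_derivative]]
  unfolding dx_def by blast

lemma dy_sum:
  "(\<And>i. i \<in> I \<Longrightarrow> h i differentiable (at p)) \<Longrightarrow> dy a (\<lambda>q. \<Sum>i\<in>I. h i q) p = (\<Sum>i\<in>I. dy a (h i) p)"
  using frechet_derivative_eqI[OF has_derivative_sum[OF has_frechet_derivative], of I h p]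
  unfolding dy_def by blast

lemma bounded_linear_snd_nth: "bounded_linear (\<lambda>q :: 'i::finite pt. snd q $ a)"
  by (intro bounded_linear_compose[OF bounded_linear_vec_nth bounded_linear_snd])

lemma dy_snd_nth: "dy d (\<lambda>q. snd q $ a) p = (if a = d then 1 else 0)"
  unfolding dy_def
  by (simp add: frechet_derivative_eqI[OF bounded_linear_imp_has_derivative[OF bounded_linear_snd_nth]] axis_def)

lemma second_derivative_vertical:
  assumes "open S" "p \<in> S" "smooth_on S h"
  shows "frechet_derivative (\<lambda>q. frechet_derivative h (at q) (0, w)) (at p) (0, w)
    = (\<Sum>a\<in>UNIV. \<Sum>b\<in>UNIV. dy a (dy b h) p * w $ a * w $ b)"
proof -
  note sm = smooth_on_differentiable[OF assms(3)] smooth_on_differentiable[OF smooth_on_dy[OF assms(3)]]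
  have "frechet_derivative (\<lambda>q. frechet_derivative h (at q) (0, w)) (at p) (0, w)
      = frechet_derivative (\<lambda>q. \<Sum>b\<in>UNIV. w $ b * dy b h q) (at p) (0, w)"
    by (simp add: frechet_derivative_cong_open[OF assms(1,2) frechet_derivative_vertical[OF sm(1)]])
  also have "\<dots> = (\<Sum>a\<in>UNIV. w $ a * dy a (\<lambda>q. \<Sum>b\<in>UNIV. w $ b * dy b h q) p)"
    using sm(2)[OF assms(2)] by (intro frechet_derivative_vertical) (auto intro!: derivative_intros)
  also have "\<dots> = (\<Sum>a\<in>UNIV. w $ a * (\<Sum>b\<in>UNIV. w $ b * dy a (dy b h) p))"
    using sm(2)[OF assms(2)] by (simp add: dy_sum dy_cmult)
  finally show ?thesis
    by (simp add: sum_distrib_left mult_ac)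
qed

text \<open>Closedness of \<open>d(E\<^sub>a dx\<^sup>a)\<close>, where \<open>E\<^sub>a\<close> is the derivative of \<open>E\<close> in the direction of \<open>y\<^sup>a\<close>.\<close>

lemma ext_deriv_hilbert_form:
  fixes E :: "'i::finite pt \<Rightarrow> real"
  assumes "open S" "p \<in> S" "smooth_on S E"
    and \<omega>: "\<And>q \<xi> \<eta>. q \<in> S \<Longrightarrow> \<omega> q \<xi> \<eta> =
      frechet_derivative (\<lambda>z. frechet_derivative E (at z) (0, fst \<xi>)) (at q) \<eta>
      - frechet_derivative (\<lambda>z. frechet_derivative E (at z) (0, fst \<eta>)) (at q) \<xi>"
  shows "ext_deriv \<omega> p u v w = 0"
proof -
  define D where "D f v = (\<lambda>z. frechet_derivative f (at z) v)" for f :: "'i pt \<Rightarrow> real" and v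
  have sm: "smooth_on S (D f v)" if "smooth_on S f" for f v
    unfolding D_def using that by (rule smooth_on_deriv)
  have deriv: "frechet_derivative (\<lambda>q. \<omega> q \<xi> \<eta>) (at p) \<zeta>
      = D (D (D E (0, fst \<xi>)) \<eta>) \<zeta> p - D (D (D E (0, fst \<eta>)) \<xi>) \<zeta> p" for \<xi> \<eta> \<zeta>
  proof -
    have "frechet_derivative (\<lambda>q. \<omega> q \<xi> \<eta>) (at p)
        = frechet_derivative (\<lambda>q. D (D E (0, fst \<xi>)) \<eta> q - D (D E (0, fst \<eta>)) \<xi> q) (at p)"
      by (rule frechet_derivative_cong_open[OF assms(1,2)]) (simp add: \<omega> D_def)
    moreover have "frechet_derivative (\<lambda>q. D (D E (0, fst \<xi>)) \<eta> q - D (D E (0, fst \<eta>)) \<xi> q) (at p) \<zeta> = D (D (D E (0, fst \<xi>)) \<eta>) \<zeta> p - D (D (D E (0, fst \<eta>)) \<xi>) \<zeta> p"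
      using frechet_derivative_eqI[OF has_derivative_diff[OF smooth_on_has_derivative smooth_on_has_derivative],
          OF sm assms(2) sm assms(2), OF sm sm, OF assms(3,3)]
      by (simp only: D_def)
    ultimately show ?thesis
      by simp
  qed
  \<comment> \<open>The six third derivatives of \<open>E\<close> in the exterior derivative cancel
    in pairs that share the innermost, vertical direction and differ in the order of the two outer
    ones.\<close>
  have swap: "D (D (D E a) b) c p = D (D (D E a) c) b p" for a b c
    using smooth_on_deriv_commute[OF assms(1,2) sm[OF assms(3)], of a b c] by (simp add: D_def)
  show ?thesis
    unfolding ext_deriv_def deriv
    by (simp add: swap[of "(0, fst u)" v w] swap[of "(0, fst v)" u w] swap[of "(0, fst w)" u v])
qed

text \<open>Euler's relation of second order, read off on a ray: with s = t - 1 the restriction of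
  \<open>h\<close> is (1 + s)^2 times a constant for s > -1. For v = (0, y) the points of the ray
  are the rescalings of y.\<close>

lemma positive_homogeneous_second_derivative:
  fixes h :: "'e::real_normed_vector \<Rightarrow> real"
  assumes "open S" "p \<in> S" "smooth_on S h"
    and hom: "\<And>t. 0 < t \<Longrightarrow> p + (t - 1) *\<^sub>R v \<in> S \<and> h (p + (t - 1) *\<^sub>R v) = t\<^sup>2 * h p"
  shows "frechet_derivative (\<lambda>q. frechet_derivative h (at q) v) (at p) v = 2 * h p"
proof -
  let ?h' = "\<lambda>q. frechet_derivative h (at q) v"
  have line: "p + s *\<^sub>R v \<in> S" "h (p + s *\<^sub>R v) = (1 + s)\<^sup>2 * h p" if "-1 < s" for s
    using hom[of "1 + s"] that by auto
  have h': "?h' (p + s *\<^sub>R v) = 2 * (1 + s) * h p" if s: "s \<in> {-1<..}" for s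
  proof (rule DERIV_unique)
    show "((\<lambda>s. h (p + s *\<^sub>R v)) has_real_derivative ?h' (p + s *\<^sub>R v)) (at s)"
      using line(1) s smooth_on_differentiable[OF assms(3)]
      by (intro has_real_derivative_along_line) simp
    have "((\<lambda>s. (1 + s)\<^sup>2 * h p) has_real_derivative 2 * (1 + s) * h p) (at s)"
      by (auto intro!: derivative_eq_intros)
    then show "((\<lambda>s. h (p + s *\<^sub>R v)) has_real_derivative 2 * (1 + s) * h p) (at s)"
      by (rule has_field_derivative_transform_within_open[OF _ open_greaterThan s]) (simp add: line)
  qed
  show ?thesis
  proof (rule DERIV_unique)
    show "((\<lambda>s. ?h' (p + s *\<^sub>R v)) has_real_derivative frechet_derivative ?h' (at p) v) (at 0)"
      using has_real_derivative_along_line[of ?h' p 0 v] assms(2)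
        smooth_on_differentiable[OF smooth_on_deriv[OF assms(3)]]
      by simp
    have "((\<lambda>s. 2 * (1 + s) * h p) has_real_derivative 2 * h p) (at 0)"
      by (auto intro!: derivative_eq_intros)
    then show "((\<lambda>s. ?h' (p + s *\<^sub>R v)) has_real_derivative 2 * h p) (at 0)"
      by (rule has_field_derivative_transform_within_open[OF _ open_greaterThan, of _ _ _ "-1"])
        (simp_all add: h')
  qed
qed

text \<open>Replaces the sum over indices by a second directional derivative. That form fits Euler's
  relation and can be split along the two factors of a product, where the index types
  differ.\<close>

lemma gmet_quadratic:
  assumes "open S" "p \<in> S" "smooth_on S (\<lambda>q. (F q)\<^sup>2)"
  shows "(\<Sum>a\<in>UNIV. \<Sum>b\<in>UNIV. gmet F a b p * w $ a * w $ b)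
    = 1 / 2 * frechet_derivative (\<lambda>q. frechet_derivative (\<lambda>q. (F q)\<^sup>2) (at q) (0, w)) (at p) (0, w)"
  unfolding second_derivative_vertical[OF assms]
  by (simp only: gmet_def sum_distrib_left mult.assoc)

lemma affine_field_has_derivative:
  fixes f :: "'i::finite \<Rightarrow> 'e::real_normed_vector \<Rightarrow> real"
  assumes "\<And>d. f d differentiable (at p)"
  shows "((\<lambda>q. (c, \<chi> d. f d q)) has_derivative (\<lambda>u. (0, \<chi> d. frechet_derivative (f d) (at p) u))) (at p)"
proof -
  have expand: "(\<chi> d. k d) = (\<Sum>d\<in>UNIV. k d *\<^sub>R axis d (1::real))" for k :: "'i \<Rightarrow> real"
    using sum_axis[of "\<chi> d. k d"] by simp
  have "((\<lambda>q. \<Sum>d\<in>UNIV. f d q *\<^sub>R axis d (1::real)) has_derivative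
      (\<lambda>u. \<Sum>d\<in>UNIV. frechet_derivative (f d) (at p) u *\<^sub>R axis d 1)) (at p)"
    by (rule has_derivative_sum, rule has_derivative_scaleR_left, rule has_frechet_derivative[OF assms])
  then show ?thesis
    unfolding expand by (rule has_derivative_Pair[OF has_derivative_const])
qed

text \<open>Both \<open>hor F a\<close> and its image under J have constant x-components, so every
  bracket needed later is vertical and given by derivatives of component functions.\<close>

lemma lie_bracket_affine_fields:
  fixes f f' :: "'i::finite \<Rightarrow> 'i pt \<Rightarrow> real"
  assumes "\<And>d. f d differentiable (at p)" "\<And>d. f' d differentiable (at p)"
  shows "lie_bracket (\<lambda>q. (c, \<chi> d. f d q)) (\<lambda>q. (c', \<chi> d. f' d q)) p
    = (0, \<chi> d. frechet_derivative (f' d) (at p) (c, \<chi> d. f d p) - frechet_derivative (f d) (at p) (c', \<chi> d. f' d p))"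
  unfolding lie_bracket_def
    frechet_derivative_eqI[OF affine_field_has_derivative[of f, OF assms(1)]]
    frechet_derivative_eqI[OF affine_field_has_derivative[of f', OF assms(2)]]
  by (simp add: prod_eq_iff vec_eq_iff)

lemma frechet_derivative_uminus:
  "f differentiable (at p) \<Longrightarrow> frechet_derivative (\<lambda>q. - f q) (at p) v = - frechet_derivative f (at p) v"
  by (rule frechet_derivative_eqI[OF has_derivative_minus[OF has_frechet_derivative]])

lemma lie_bracket_commute: "lie_bracket X Y p = - lie_bracket Y X p"
  by (simp add: lie_bracket_def)

section \<open>The Oproiu structure in one chart\<close>

lemma sum_mult_assoc:
  fixes u :: "'a \<Rightarrow> real"
  shows "(\<Sum>a\<in>I. (\<Sum>c\<in>K. u c * M c a) * N a) = (\<Sum>c\<in>K. u c * (\<Sum>a\<in>I. M c a * N a))"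
  unfolding sum_distrib_left sum_distrib_right mult.assoc by (rule sum.swap)

lemma sum_delta_mult:
  fixes f :: "'i::finite \<Rightarrow> real"
  shows "(\<Sum>b\<in>UNIV. (if a = b then 1 else 0) * f b) = f a"
    and "(\<Sum>b\<in>UNIV. (if b = a then 1 else 0) * f b) = f a"
    and "(\<Sum>b\<in>UNIV. f b * (if a = b then 1 else 0)) = f a"
    and "(\<Sum>b\<in>UNIV. f b * (if b = a then 1 else 0)) = f a"
proof -
  have "(if a = b then 1 else 0) * f b = (if a = b then f b else 0)" for b
    by simp
  then show 1: "(\<Sum>b\<in>UNIV. (if a = b then 1 else 0) * f b) = f a"
    by simp
  then show "(\<Sum>b\<in>UNIV. (if b = a then 1 else 0) * f b) = f a"
    by (simp only: eq_commute[of _ a])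
  then show "(\<Sum>b\<in>UNIV. f b * (if b = a then 1 else 0)) = f a"
    by (simp only: mult.commute[of "f _"])
  from 1 show "(\<Sum>b\<in>UNIV. f b * (if a = b then 1 else 0)) = f a"
    by (simp only: mult.commute[of "f _"])
qed

text \<open>All metric conditions are on the square of \<open>F\<close>. Asking for smoothness of
  \<tau> on the positive reals fits, since \<open>F^2\<close> is shown to be positive on
  \<open>U\<close>.\<close>

locale oproiu_chart =
  fixes U :: "'i::finite pt set" and F :: "'i pt \<Rightarrow> real"
    and A B :: real and \<tau> :: "real \<Rightarrow> real"
  assumes open_U: "open U"
    and smooth_F2: "smooth_on U (\<lambda>q. (F q)\<^sup>2)"
    and gmet_pos: "p \<in> U \<Longrightarrow> w \<noteq> 0 \<Longrightarrow> 0 < (\<Sum>a\<in>UNIV. \<Sum>b\<in>UNIV. gmet F a b p * w $ a * w $ b)"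
    and homogeneous: "p \<in> U \<Longrightarrow> 0 < t \<Longrightarrow>
      (fst p, t *\<^sub>R snd p) \<in> U \<and> (F (fst p, t *\<^sub>R snd p))\<^sup>2 = t\<^sup>2 * (F p)\<^sup>2"
    and slit: "p \<in> U \<Longrightarrow> snd p \<noteq> 0"
    and A_nz: "A \<noteq> 0" and B_nz: "B \<noteq> 0"
    and smooth_\<tau>: "smooth_on {0<..} \<tau>"
    and denominator_nz: "p \<in> U \<Longrightarrow> B + (F p)\<^sup>2 * \<tau> ((F p)\<^sup>2) \<noteq> 0"
begin

abbreviation "g \<equiv> gmet F"
abbreviation "gi \<equiv> ginv F"
abbreviation "Yl \<equiv> ylow F"
abbreviation "Pl \<equiv> Plow F A B \<tau>"
abbreviation "Ql \<equiv> Qlow F A B \<tau>"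
abbreviation "Pm \<equiv> Pmix F A B \<tau>"
abbreviation "Qm \<equiv> Qmix F A B \<tau>"
abbreviation "G \<equiv> Gtilde F A B \<tau>"
abbreviation "J \<equiv> Jtilde F A B \<tau>"

subsection \<open>The fundamental tensor\<close>

lemma smooth_g: "smooth_on U (g a b)"
  unfolding gmet_def[abs_def]
  by (intro smooth_on_mult smooth_on_const smooth_on_dy smooth_F2 open_U)

lemma g_commute: "p \<in> U \<Longrightarrow> g a b p = g b a p"
  unfolding gmet_def using dy_dy_commute[OF open_U _ smooth_F2] by simp

lemma g_y_y:
  assumes "p \<in> U"
  shows "(\<Sum>a\<in>UNIV. \<Sum>b\<in>UNIV. g a b p * snd p $ a * snd p $ b) = (F p)\<^sup>2"
proof -
  have "p + (t - 1) *\<^sub>R (0, snd p) = (fst p, t *\<^sub>R snd p)" for t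
    by (simp add: prod_eq_iff algebra_simps)
  then show ?thesis
    using positive_homogeneous_second_derivative[OF open_U assms smooth_F2, of "(0, snd p)"]
      homogeneous[OF assms]
    by (simp add: gmet_quadratic[OF open_U assms smooth_F2])
qed

text \<open>By Euler's relation \<open>F^2\<close> is the value of the positive definite form g on
  y, and y is nonzero. Hence \<tau> is only evaluated where it is smooth.\<close>

lemma F2_pos: "p \<in> U \<Longrightarrow> 0 < (F p)\<^sup>2"
  using gmet_pos[of p "snd p"] slit[of p] g_y_y[of p] by metis

lemma det_g:
  assumes "p \<in> U"
  shows "det (\<chi> a b. g a b p) \<noteq> 0"
proof -
  have "w = 0" if "(\<chi> a b. g a b p) *v w = 0" for w
  proof (rule ccontr)
    assume "w \<noteq> 0"
    have "(\<Sum>b\<in>UNIV. g a b p * w $ b) = 0" for a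
      using arg_cong[OF that, of "\<lambda>v. v $ a"] by (simp add: matrix_vector_mult_def)
    then have "(\<Sum>a\<in>UNIV. w $ a * (\<Sum>b\<in>UNIV. g a b p * w $ b)) = 0"
      by simp
    then show False
      using gmet_pos[OF assms \<open>w \<noteq> 0\<close>] by (simp add: sum_distrib_left mult_ac)
  qed
  then show ?thesis
    unfolding invertible_det_nz[symmetric] invertible_left_inverse matrix_left_invertible_ker
    by blast
qed

lemma g_ginv:
  assumes "p \<in> U"
  shows "(\<Sum>c\<in>UNIV. g a c p * gi c b p) = (if a = b then 1 else 0)"
    and "(\<Sum>c\<in>UNIV. gi a c p * g c b p) = (if a = b then 1 else 0)"
proof -
  show "(\<Sum>c\<in>UNIV. g a c p * gi c b p) = (if a = b then 1 else 0)"
    using arg_cong[OF matrix_inv_inverse(1)[OF det_g[OF assms]], of "\<lambda>M. M $ a $ b"]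
    by (simp add: ginv_def matrix_matrix_mult_def mat_def)
  show "(\<Sum>c\<in>UNIV. gi a c p * g c b p) = (if a = b then 1 else 0)"
    using arg_cong[OF matrix_inv_inverse(2)[OF det_g[OF assms]], of "\<lambda>M. M $ a $ b"]
    by (simp add: ginv_def matrix_matrix_mult_def mat_def)
qed

lemma ginv_contract:
  assumes "p \<in> U"
  shows "(\<Sum>a\<in>UNIV. (\<Sum>c\<in>UNIV. u c * gi c a p) * g a b p) = u b"
  unfolding sum_mult_assoc g_ginv[OF assms] by (rule sum_delta_mult)

lemma ylow_ginv:
  assumes "p \<in> U"
  shows "(\<Sum>c\<in>UNIV. Yl c p * gi c b p) = snd p $ b"
proof -
  have "Yl c p = (\<Sum>e\<in>UNIV. snd p $ e * g e c p)" for c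
    by (simp add: ylow_def g_commute[OF assms, of c] mult.commute)
  then show ?thesis
    by (simp only: sum_mult_assoc g_ginv[OF assms] sum_delta_mult)
qed

lemma ylow_y: "p \<in> U \<Longrightarrow> (\<Sum>a\<in>UNIV. snd p $ a * Yl a p) = (F p)\<^sup>2"
  by (simp add: g_y_y[symmetric] ylow_def sum_distrib_left mult_ac)

lemma smooth_ginv: "smooth_on U (gi a b)"
  unfolding ginv_def[abs_def]
  by (rule smooth_on_matrix_inv[OF open_U]) (simp_all add: smooth_g det_g)

lemma smooth_snd: "smooth_on U (\<lambda>q. snd q $ a)"
  by (rule smooth_on_bounded_linear[OF open_U bounded_linear_snd_nth])

lemma smooth_ylow: "smooth_on U (Yl a)"
  unfolding ylow_def[abs_def] by (intro smooth_on_sum smooth_on_mult smooth_g smooth_snd open_U)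

lemma smooth_spray: "smooth_on U (spray F a)"
  unfolding spray_def[abs_def]
  by (intro smooth_on_mult smooth_on_const smooth_on_sum smooth_on_diff smooth_on_dy smooth_on_dx
      smooth_ginv smooth_snd smooth_F2 open_U)

lemma smooth_conn: "smooth_on U (conn F a b)"
  unfolding conn_def by (rule smooth_on_dy[OF smooth_spray])

lemma dconn_commute: "p \<in> U \<Longrightarrow> dconn F d a b p = dconn F d b a p"
  unfolding dconn_def conn_def by (rule dy_dy_commute[OF open_U _ smooth_spray])

lemma smooth_\<tau>_F2: "smooth_on U (\<lambda>q. \<tau> ((F q)\<^sup>2))"
  by (rule smooth_on_compose_real[OF open_U _ smooth_\<tau> smooth_F2])
    (use F2_pos in \<open>blast intro: greaterThan_iff[THEN iffD2]\<close>)

lemma smooth_Plow: "smooth_on U (Pl a b)"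
  unfolding Plow_def[abs_def]
  by (intro smooth_on_add smooth_on_mult smooth_on_divide smooth_on_const smooth_g smooth_ylow
      smooth_\<tau>_F2 open_U) (simp add: A_nz B_nz)

lemma smooth_Qlow: "smooth_on U (Ql a b)"
  unfolding Qlow_def[abs_def]
  by (intro smooth_on_diff smooth_on_add smooth_on_mult smooth_on_divide smooth_on_const smooth_g
      smooth_ylow smooth_\<tau>_F2 smooth_F2 open_U denominator_nz)

lemma smooth_Pmix: "smooth_on U (Pm a b)"
  unfolding Pmix_def[abs_def] by (intro smooth_on_sum smooth_on_mult smooth_Plow smooth_ginv open_U)

lemma smooth_Qmix: "smooth_on U (Qm a b)"
  unfolding Qmix_def[abs_def] by (intro smooth_on_sum smooth_on_mult smooth_Qlow smooth_ginv open_U)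

subsection \<open>The tensors \<open>P\<close> and \<open>Q\<close>\<close>

lemma Plow_commute: "p \<in> U \<Longrightarrow> Pl a b p = Pl b a p"
  by (simp add: Plow_def g_commute[of p a b])

lemma Qlow_commute: "p \<in> U \<Longrightarrow> Ql a b p = Ql b a p"
  by (simp add: Qlow_def g_commute[of p a b])

lemma Pmix_g: "p \<in> U \<Longrightarrow> (\<Sum>a\<in>UNIV. Pm c a p * g a b p) = Pl c b p"
  by (simp add: Pmix_def ginv_contract)

lemma Qmix_g: "p \<in> U \<Longrightarrow> (\<Sum>a\<in>UNIV. Qm c a p * g a b p) = Ql c b p"
  by (simp add: Qmix_def ginv_contract)

lemma Pmix_eq:
  assumes "p \<in> U"
  shows "Pm a b p = 1 / A * (if a = b then 1 else 0) + \<tau> ((F p)\<^sup>2) / (A * B) * Yl a p * snd p $ b"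
proof -
  have "Pm a b p = 1 / A * (\<Sum>c\<in>UNIV. g a c p * gi c b p)
      + \<tau> ((F p)\<^sup>2) / (A * B) * Yl a p * (\<Sum>c\<in>UNIV. Yl c p * gi c b p)"
    by (simp add: Pmix_def Plow_def distrib_right sum.distrib sum_distrib_left mult.assoc)
  then show ?thesis
    by (simp only: g_ginv[OF assms] ylow_ginv[OF assms])
qed

lemma Qmix_eq:
  assumes "p \<in> U"
  shows "Qm a b p = A * (if a = b then 1 else 0)
    - A * \<tau> ((F p)\<^sup>2) / (B + (F p)\<^sup>2 * \<tau> ((F p)\<^sup>2)) * Yl a p * snd p $ b"
proof -
  have "Qm a b p = A * (\<Sum>c\<in>UNIV. g a c p * gi c b p)
      - A * \<tau> ((F p)\<^sup>2) / (B + (F p)\<^sup>2 * \<tau> ((F p)\<^sup>2)) * Yl a p * (\<Sum>c\<in>UNIV. Yl c p * gi c b p)"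
    by (simp add: Qmix_def Qlow_def left_diff_distrib sum_subtractf sum_distrib_left mult.assoc)
  then show ?thesis
    by (simp only: g_ginv[OF assms] ylow_ginv[OF assms])
qed

text \<open>The mixed tensors P and Q are multiples of the identity plus a rank one part
  \<open>y_a y^b\<close>. Such maps are closed under composition, the quadratic term contributing
  the factor \<open>y^b y_b = F^2\<close>.\<close>

lemma rank_one_update_mult:
  assumes "p \<in> U"
  shows "(\<Sum>b\<in>UNIV. (k * (if a = b then 1 else 0) + s * Yl a p * snd p $ b) *
      (l * (if b = c then 1 else 0) + t * Yl b p * snd p $ c))
    = k * l * (if a = c then 1 else 0) + (k * t + s * l + s * t * (F p)\<^sup>2) * Yl a p * snd p $ c"
proof -
  have "(k * (if a = b then 1 else 0) + s * Yl a p * snd p $ b) *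
      (l * (if b = c then 1 else 0) + t * Yl b p * snd p $ c)
    = k * l * ((if a = b then 1 else 0) * (if b = c then 1 else 0))
      + k * t * snd p $ c * ((if a = b then 1 else 0) * Yl b p)
      + s * l * Yl a p * (snd p $ b * (if b = c then 1 else 0))
      + s * t * Yl a p * snd p $ c * (snd p $ b * Yl b p)" for b
    by (simp add: algebra_simps)
  then show ?thesis
    by (simp only: sum.distrib sum_distrib_left[symmetric] sum_delta_mult ylow_y[OF assms])
      (simp add: algebra_simps)
qed

lemma Pmix_Qmix:
  assumes "p \<in> U"
  shows "(\<Sum>b\<in>UNIV. Pm a b p * Qm b c p) = (if a = c then 1 else 0)"
    and "(\<Sum>b\<in>UNIV. Qm a b p * Pm b c p) = (if a = c then 1 else 0)"
proof -
  define s where "s = \<tau> ((F p)\<^sup>2) / (A * B)"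
  define t where "t = - (A * \<tau> ((F p)\<^sup>2) / (B + (F p)\<^sup>2 * \<tau> ((F p)\<^sup>2)))"
  have P: "Pm a b p = 1 / A * (if a = b then 1 else 0) + s * Yl a p * snd p $ b" for a b
    by (simp add: Pmix_eq[OF assms] s_def)
  have Q: "Qm a b p = A * (if a = b then 1 else 0) + t * Yl a p * snd p $ b" for a b
    by (simp add: Qmix_eq[OF assms] t_def)
  \<comment> \<open>The rank one coefficient of the composite. Solving this equation for
    \<open>t\<close> is where the denominator \<open>B + F^2 \<tau>\<close> in Q comes from.\<close>
  have st: "1 / A * t + s * A + s * t * (F p)\<^sup>2 = 0"
    using A_nz B_nz denominator_nz[OF assms] unfolding s_def t_def by (simp add: field_simps)
  then have st': "A * s + t * (1 / A) + t * s * (F p)\<^sup>2 = 0"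
    by (simp add: mult_ac)
  show "(\<Sum>b\<in>UNIV. Pm a b p * Qm b c p) = (if a = c then 1 else 0)"
    unfolding P Q rank_one_update_mult[OF assms] st using A_nz by simp
  show "(\<Sum>b\<in>UNIV. Qm a b p * Pm b c p) = (if a = c then 1 else 0)"
    unfolding P Q rank_one_update_mult[OF assms] st' using A_nz by simp
qed

text \<open>Lowered P is mixed P followed by g; after cancelling mixed Q against mixed P only g
  remains.\<close>

lemma Plow_Qmix:
  assumes "p \<in> U"
  shows "(\<Sum>b\<in>UNIV. Pl a b p * Qm c b p) = g c a p"
proof -
  have "Pl a b p = (\<Sum>e\<in>UNIV. Pm b e p * g e a p)" for b
    by (simp only: Pmix_g[OF assms] Plow_commute[OF assms, of a])
  then have "(\<Sum>b\<in>UNIV. Pl a b p * Qm c b p) = (\<Sum>b\<in>UNIV. Qm c b p * (\<Sum>e\<in>UNIV. Pm b e p * g e a p))"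
    by (simp only: mult.commute)
  then show ?thesis
    by (simp only: sum_mult_assoc[symmetric] Pmix_Qmix[OF assms] sum_delta_mult)
qed

lemma Qlow_Pmix:
  assumes "p \<in> U"
  shows "(\<Sum>b\<in>UNIV. Ql a b p * Pm c b p) = g c a p"
proof -
  have "Ql a b p = (\<Sum>e\<in>UNIV. Qm b e p * g e a p)" for b
    by (simp only: Qmix_g[OF assms] Qlow_commute[OF assms, of a])
  then have "(\<Sum>b\<in>UNIV. Ql a b p * Pm c b p) = (\<Sum>b\<in>UNIV. Pm c b p * (\<Sum>e\<in>UNIV. Qm b e p * g e a p))"
    by (simp only: mult.commute)
  then show ?thesis
    by (simp only: sum_mult_assoc[symmetric] Pmix_Qmix[OF assms] sum_delta_mult)
qed

subsection \<open>The adapted frame\<close>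

lemma hor_eq: "hor F a p = (axis a 1, \<chi> d. - conn F d a p)"
  by (simp add: hor_def vert_def prod_eq_iff fst_sum snd_sum vec_eq_iff axis_def if_distrib cong: if_cong)

lemma cox_hor: "cox b (hor F a p) = (if b = a then 1 else 0)"
  by (simp add: cox_def hor_eq axis_def)

lemma coy_hor: "coy F b p (hor F a p) = 0"
  by (simp add: coy_def hor_eq axis_def sum_delta_mult)

lemma cox_vert: "cox b (vert a p) = 0"
  by (simp add: cox_def vert_def)

lemma coy_vert: "coy F b p (vert a q) = (if b = a then 1 else 0)"
  by (simp add: coy_def vert_def axis_def)

lemma cox_linear: "cox b (\<xi> + \<eta>) = cox b \<xi> + cox b \<eta>" "cox b (c *\<^sub>R \<xi>) = c * cox b \<xi>"
  "cox b (\<xi> - \<eta>) = cox b \<xi> - cox b \<eta>" "cox b (- \<xi>) = - cox b \<xi>"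
  "cox b (\<Sum>i\<in>I. f i) = (\<Sum>i\<in>I. cox b (f i))"
  by (simp_all add: cox_def fst_sum)

lemma linear_coy: "linear (coy F b p)"
  unfolding coy_def by (intro linearI) (simp_all add: sum.distrib sum_distrib_left algebra_simps)

lemmas coy_linear = linear_add[OF linear_coy] linear_scale[OF linear_coy] linear_diff[OF linear_coy]
  linear_neg[OF linear_coy] linear_sum[OF linear_coy]

lemma frame_eqI:
  assumes "\<And>a. cox a \<xi> = cox a \<eta>" "\<And>a. coy F a p \<xi> = coy F a p \<eta>"
  shows "\<xi> = \<eta>"
  using assms unfolding cox_def coy_def by (simp add: prod_eq_iff vec_eq_iff)

lemma frame_expand:
  "\<xi> = (\<Sum>a\<in>UNIV. cox a \<xi> *\<^sub>R hor F a p) + (\<Sum>a\<in>UNIV. coy F a p \<xi> *\<^sub>R vert a p)"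
  by (rule frame_eqI[of _ _ p])
    (simp_all add: cox_linear coy_linear cox_hor coy_hor cox_vert coy_vert sum_delta_mult)

lemma cox_J: "cox b (J p \<xi>) = (\<Sum>a\<in>UNIV. coy F a p \<xi> * Qm a b p)"
  by (simp add: Jtilde_def cox_linear cox_hor cox_vert sum_delta_mult)

lemma coy_J: "coy F b p (J p \<xi>) = - (\<Sum>a\<in>UNIV. cox a \<xi> * Pm a b p)"
  by (simp add: Jtilde_def coy_linear coy_hor coy_vert sum_delta_mult)

lemma linear_J: "linear (J p)"
  by (intro linearI; rule frame_eqI[of _ _ p])
    (simp_all add: cox_linear coy_linear cox_J coy_J sum.distrib sum_distrib_left algebra_simps)

lemma J_hor: "J p (hor F a p) = - (\<Sum>b\<in>UNIV. Pm a b p *\<^sub>R vert b p)"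
  by (rule frame_eqI[of _ _ p])
    (simp_all add: cox_J coy_J cox_linear coy_linear cox_hor coy_hor cox_vert coy_vert sum_delta_mult)

lemma J_J:
  assumes "p \<in> U"
  shows "J p (J p \<xi>) = - \<xi>"
proof (rule frame_eqI[of _ _ p])
  fix b :: 'i
  show "cox b (J p (J p \<xi>)) = cox b (- \<xi>)" "coy F b p (J p (J p \<xi>)) = coy F b p (- \<xi>)"
    by (simp_all add: cox_J coy_J sum_negf cox_linear coy_linear sum_mult_assoc
        Pmix_Qmix[OF assms] sum_delta_mult)
qed

subsection \<open>Hermitian property and closedness of the fundamental form\<close>

text \<open>Serves both halves of \<open>G p \<xi> (J p \<eta>)\<close>: lowered P meets mixed Q in
  one, lowered Q meets mixed P in the other. Both collapse to g, so the fundamental form is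
  \<open>g_ab\<close> dx^a wedge \<delta>y^b, without A, B or \<tau>.\<close>

lemma low_contract:
  assumes p: "p \<in> U" and "\<And>a c. (\<Sum>b\<in>UNIV. N a b * M c b) = g c a p"
  shows "(\<Sum>a\<in>UNIV. \<Sum>b\<in>UNIV. N a b * u a * (\<Sum>c\<in>UNIV. v c * M c b))
    = (\<Sum>a\<in>UNIV. \<Sum>b\<in>UNIV. g a b p * u a * v b)"
proof -
  have "(\<Sum>b\<in>UNIV. N a b * u a * (\<Sum>c\<in>UNIV. v c * M c b)) = (\<Sum>b\<in>UNIV. g a b p * u a * v b)" for a
  proof -
    have "(\<Sum>b\<in>UNIV. N a b * u a * (\<Sum>c\<in>UNIV. v c * M c b))
        = u a * (\<Sum>b\<in>UNIV. (\<Sum>c\<in>UNIV. v c * M c b) * N a b)"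
      by (simp add: sum_distrib_left mult_ac)
    also have "\<dots> = u a * (\<Sum>c\<in>UNIV. v c * g a c p)"
      unfolding sum_mult_assoc using assms(2)[of a] g_commute[OF p, of a]
      by (simp add: mult.commute)
    finally show ?thesis
      by (simp add: sum_distrib_left mult_ac)
  qed
  then show ?thesis
    by simp
qed

text \<open>The way back for the Hermitian property: in \<open>G_J_right\<close> with first argument
  \<open>J p \<xi>\<close>, the coefficients of J contract with g to lowered Q and lowered P
  again.\<close>

lemma g_contract:
  assumes "\<And>b c. (\<Sum>a\<in>UNIV. M c a * g a b p) = N c b"
  shows "(\<Sum>a\<in>UNIV. \<Sum>b\<in>UNIV. g a b p * (\<Sum>c\<in>UNIV. u c * M c a) * v b)
    = (\<Sum>a\<in>UNIV. \<Sum>b\<in>UNIV. N a b * u a * v b)"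
proof -
  have "(\<Sum>a\<in>UNIV. \<Sum>b\<in>UNIV. g a b p * (\<Sum>c\<in>UNIV. u c * M c a) * v b)
      = (\<Sum>b\<in>UNIV. v b * (\<Sum>a\<in>UNIV. (\<Sum>c\<in>UNIV. u c * M c a) * g a b p))"
    by (subst sum.swap) (simp add: sum_distrib_left mult_ac)
  also have "\<dots> = (\<Sum>b\<in>UNIV. v b * (\<Sum>c\<in>UNIV. u c * N c b))"
    unfolding sum_mult_assoc assms ..
  also have "\<dots> = (\<Sum>b\<in>UNIV. \<Sum>c\<in>UNIV. N c b * u c * v b)"
    by (simp add: sum_distrib_left mult_ac)
  finally show ?thesis
    by (subst sum.swap)
qed

lemma G_J_right:
  assumes "p \<in> U"
  shows "G p \<xi> (J p \<eta>) = (\<Sum>a\<in>UNIV. \<Sum>b\<in>UNIV. g a b p * cox a \<xi> * coy F b p \<eta>)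
    - (\<Sum>a\<in>UNIV. \<Sum>b\<in>UNIV. g a b p * coy F a p \<xi> * cox b \<eta>)"
  by (simp only: Gtilde_def cox_J coy_J mult_minus_right sum_negf low_contract[OF assms Plow_Qmix[OF assms]]
      low_contract[OF assms Qlow_Pmix[OF assms]] add_uminus_conv_diff)

lemma hermitian_on_U: "hermitian_on U G J"
  unfolding hermitian_on_def
proof (intro ballI allI)
  fix p \<xi> \<eta> assume p: "p \<in> U"
  show "G p (J p \<xi>) (J p \<eta>) = G p \<xi> \<eta>"
    unfolding G_J_right[OF p] cox_J coy_J
    by (simp only: mult_minus_left mult_minus_right sum_negf g_contract[of "\<lambda>a b. Qm a b p", OF Qmix_g[OF p]]
        g_contract[of "\<lambda>a b. Pm a b p", OF Pmix_g[OF p]] Gtilde_def)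
qed

section \<open>The nonlinear connection and the Hilbert form\<close>

abbreviation "E \<equiv> \<lambda>q. 1 / 2 * (F q)\<^sup>2"

lemma smooth_E: "smooth_on U E"
  by (intro smooth_on_mult smooth_on_const smooth_F2 open_U)

lemma dy_dy_E:
  assumes "p \<in> U"
  shows "dy a (dy b E) p = g a b p"
proof -
  have "dy a (dy b E) p = dy a (\<lambda>q. 1 / 2 * dy b (\<lambda>q. (F q)\<^sup>2) q) p"
    by (rule dy_cong[OF open_U assms], rule dy_cmult, rule smooth_on_differentiable[OF smooth_F2])
  also have "\<dots> = g a b p"
    unfolding gmet_def
    by (rule dy_cmult, rule smooth_on_differentiable[OF smooth_on_dy[OF smooth_F2] assms])
  finally show ?thesis .
qed

lemma dx_dy_E:
  assumes "p \<in> U"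
  shows "dx a (dy b E) p = 1 / 2 * dy b (dx a (\<lambda>q. (F q)\<^sup>2)) p"
proof -
  have "dx a (dy b E) p = dy b (dx a E) p"
    by (rule dy_dx_commute[OF open_U assms smooth_E, symmetric])
  also have "\<dots> = dy b (\<lambda>q. 1 / 2 * dx a (\<lambda>q. (F q)\<^sup>2) q) p"
    by (rule dy_cong[OF open_U assms], rule dx_cmult, rule smooth_on_differentiable[OF smooth_F2])
  also have "\<dots> = 1 / 2 * dy b (dx a (\<lambda>q. (F q)\<^sup>2)) p"
    by (rule dy_cmult, rule smooth_on_differentiable[OF smooth_on_dx[OF smooth_F2] assms])
  finally show ?thesis .
qed

text \<open>Lowering the index removes the inverse of g, so the next y-derivative involves no
  derivative of \<open>g^ab\<close>.\<close>

lemma g_spray: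
  assumes "p \<in> U"
  shows "(\<Sum>b\<in>UNIV. g a b p * spray F b p) =
    1 / 4 * ((\<Sum>c\<in>UNIV. dy a (dx c (\<lambda>q. (F q)\<^sup>2)) p * snd p $ c) - dx a (\<lambda>q. (F q)\<^sup>2) p)"
proof -
  let ?S = "\<lambda>b. (\<Sum>c\<in>UNIV. dy b (dx c (\<lambda>q. (F q)\<^sup>2)) p * snd p $ c) - dx b (\<lambda>q. (F q)\<^sup>2) p"
  have "(\<Sum>b\<in>UNIV. g a b p * spray F b p)
      = 1 / 4 * (\<Sum>b\<in>UNIV. g a b p * (\<Sum>e\<in>UNIV. gi b e p * ?S e))"
    unfolding spray_def by (simp only: sum_distrib_left mult.left_commute)
  then show ?thesis
    by (simp only: sum_mult_assoc[symmetric] g_ginv[OF assms] sum_delta_mult)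
qed

text \<open>The y^d-derivative of both sides of \<open>g_spray\<close>. The first term on the right
  stems from differentiating the factor y^c, the last one from differentiating g.\<close>

lemma g_conn:
  assumes p: "p \<in> U"
  shows "(\<Sum>b\<in>UNIV. g a b p * conn F b d p) = 1 / 4 * (dy a (dx d (\<lambda>q. (F q)\<^sup>2)) p
      + (\<Sum>c\<in>UNIV. dy d (dy a (dx c (\<lambda>q. (F q)\<^sup>2))) p * snd p $ c) - dy d (dx a (\<lambda>q. (F q)\<^sup>2)) p)
    - (\<Sum>b\<in>UNIV. dy d (g a b) p * spray F b p)"
proof -
  let ?H = "\<lambda>q. (F q)\<^sup>2"
  note D = smooth_on_differentiable[OF _ p]
  have lhs: "dy d (\<lambda>q. \<Sum>b\<in>UNIV. g a b q * spray F b q) p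
      = (\<Sum>b\<in>UNIV. g a b p * conn F b d p) + (\<Sum>b\<in>UNIV. dy d (g a b) p * spray F b p)"
    by (subst dy_sum)
      (simp_all add: D smooth_on_mult[OF open_U] smooth_g smooth_spray dy_mult conn_def sum.distrib)
  have "dy d (\<lambda>q. 1 / 4 * ((\<Sum>c\<in>UNIV. dy a (dx c ?H) q * snd q $ c) - dx a ?H q)) p
      = 1 / 4 * dy d (\<lambda>q. (\<Sum>c\<in>UNIV. dy a (dx c ?H) q * snd q $ c) - dx a ?H q) p"
    by (intro dy_cmult D smooth_on_sum smooth_on_diff smooth_on_mult smooth_on_dy smooth_on_dx
        smooth_F2 smooth_snd open_U)
  also have "\<dots> = 1 / 4 * (dy d (\<lambda>q. \<Sum>c\<in>UNIV. dy a (dx c ?H) q * snd q $ c) p - dy d (dx a ?H) p)"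
    by (subst dy_diff) (auto intro!: D smooth_on_sum smooth_on_mult smooth_on_dy smooth_on_dx
        smooth_F2 smooth_snd open_U)
  also have "dy d (\<lambda>q. \<Sum>c\<in>UNIV. dy a (dx c ?H) q * snd q $ c) p
      = (\<Sum>c\<in>UNIV. dy d (\<lambda>q. dy a (dx c ?H) q * snd q $ c) p)"
    by (intro dy_sum D smooth_on_mult smooth_on_dy smooth_on_dx smooth_F2 smooth_snd open_U)
  also have "\<dots> = (\<Sum>c\<in>UNIV. dy a (dx c ?H) p * dy d (\<lambda>q. snd q $ c) p + dy d (dy a (dx c ?H)) p * snd p $ c)"
    by (intro sum.cong refl dy_mult D smooth_on_dy smooth_on_dx smooth_F2 smooth_snd)
  also have "\<dots> = dy a (dx d ?H) p + (\<Sum>c\<in>UNIV. dy d (dy a (dx c ?H)) p * snd p $ c)"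
    by (simp only: dy_snd_nth sum.distrib sum_delta_mult)
  finally have rhs: "dy d (\<lambda>q. 1 / 4 * ((\<Sum>c\<in>UNIV. dy a (dx c ?H) q * snd q $ c) - dx a ?H q)) p
      = 1 / 4 * (dy a (dx d ?H) p + (\<Sum>c\<in>UNIV. dy d (dy a (dx c ?H)) p * snd p $ c) - dy d (dx a ?H) p)" .
  have "dy d (\<lambda>q. \<Sum>b\<in>UNIV. g a b q * spray F b q) p
      = dy d (\<lambda>q. 1 / 4 * ((\<Sum>c\<in>UNIV. dy a (dx c ?H) q * snd q $ c) - dx a ?H q)) p"
    by (rule dy_cong[OF open_U p g_spray])
  with lhs rhs show ?thesis
    by linarith
qed

text \<open>In \<open>g_conn\<close> the terms with third derivatives of \<open>F^2\<close> are
  symmetric in a and d. The second-order terms are a quarter of an antisymmetric expression, and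
  subtracting half of one mixed derivative turns it into minus a quarter of the sum of both
  orders.\<close>

lemma g_conn_symmetric:
  assumes p: "p \<in> U"
  shows "(\<Sum>b\<in>UNIV. g a b p * conn F b d p) - dx d (dy a E) p
    = (\<Sum>b\<in>UNIV. g d b p * conn F b a p) - dx a (dy d E) p"
proof -
  let ?H = "\<lambda>q. (F q)\<^sup>2"
  have "dy d (dy a (dx c ?H)) p = dy a (dy d (dx c ?H)) p" for c
    by (rule dy_dy_commute[OF open_U p smooth_on_dx[OF smooth_F2]])
  moreover have "dy d (g a b) p = dy a (g d b) p" for b
    unfolding gmet_def[abs_def]
    using dy_dy_commute[OF open_U p smooth_on_dy[OF smooth_F2], of d a b]
      dy_cmult[OF smooth_on_differentiable[OF smooth_on_dy[OF smooth_on_dy[OF smooth_F2]] p]]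
    by (simp only:)
  ultimately show ?thesis
    unfolding g_conn[OF p] dx_dy_E[OF p] by (simp add: field_simps)
qed

lemma E_second_derivative:
  assumes "p \<in> U"
  shows "frechet_derivative (\<lambda>z. frechet_derivative E (at z) (0, w)) (at p) \<eta>
    = (\<Sum>a\<in>UNIV. \<Sum>c\<in>UNIV. w $ a * cox c \<eta> * dx c (dy a E) p)
      + (\<Sum>a\<in>UNIV. \<Sum>c\<in>UNIV. g a c p * w $ a * snd \<eta> $ c)"
proof -
  note smE = smooth_on_dy[OF smooth_E]
  have "frechet_derivative (\<lambda>z. frechet_derivative E (at z) (0, w)) (at p)
      = frechet_derivative (\<lambda>z. \<Sum>a\<in>UNIV. w $ a * dy a E z) (at p)"
    by (rule frechet_derivative_cong_open[OF open_U assms])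
      (rule frechet_derivative_vertical[OF smooth_on_differentiable[OF smooth_E]])
  moreover have "frechet_derivative (\<lambda>z. \<Sum>a\<in>UNIV. w $ a * dy a E z) (at p) \<eta>
      = (\<Sum>a\<in>UNIV. w $ a * frechet_derivative (dy a E) (at p) \<eta>)"
    by (rule frechet_derivative_eqI, rule has_derivative_sum, rule has_derivative_mult_right,
        rule smooth_on_has_derivative[OF smE assms])
  moreover have "frechet_derivative (dy a E) (at p) \<eta>
      = (\<Sum>c\<in>UNIV. cox c \<eta> * dx c (dy a E) p) + (\<Sum>c\<in>UNIV. snd \<eta> $ c * g a c p)" for a
    by (simp only: frechet_derivative_pt[OF smooth_on_differentiable[OF smE assms]] cox_def
        dy_dy_E[OF assms] g_commute[OF assms, of a])
  ultimately show ?thesis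
    by (simp add: distrib_left sum.distrib sum_distrib_left mult_ac)
qed

text \<open>In the adapted coframe, d(E_a dx^a) has as dx-dx part the antisymmetrized horizontal
  derivative of E_a, which vanishes by \<open>g_conn_symmetric\<close>. The mixed part is g, as in
  the fundamental form.\<close>

lemma G_J_eq:
  assumes "p \<in> U"
  shows "G p \<xi> (J p \<eta>) =
    frechet_derivative (\<lambda>z. frechet_derivative E (at z) (0, fst \<xi>)) (at p) \<eta>
    - frechet_derivative (\<lambda>z. frechet_derivative E (at z) (0, fst \<eta>)) (at p) \<xi>"
proof -
  \<comment> \<open>\<open>N a c\<close> is minus the horizontal derivative of E_a in direction c;
    \<open>T\<close> is the mixed part in the adapted coframe.\<close>
  define N where "N a c = (\<Sum>b\<in>UNIV. g a b p * conn F b c p) - dx c (dy a E) p" for a c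
  define T where "T u \<zeta> = (\<Sum>a\<in>UNIV. \<Sum>b\<in>UNIV. g a b p * u $ a * coy F b p \<zeta>)" for u :: "real ^ 'i" and \<zeta>
  have T: "T u \<zeta> - frechet_derivative (\<lambda>z. frechet_derivative E (at z) (0, u)) (at p) \<zeta>
      = (\<Sum>a\<in>UNIV. \<Sum>c\<in>UNIV. u $ a * cox c \<zeta> * N a c)" for u \<zeta>
  proof -
    have "(\<Sum>b\<in>UNIV. g a b p * coy F b p \<zeta>)
        = (\<Sum>b\<in>UNIV. g a b p * snd \<zeta> $ b) + (\<Sum>c\<in>UNIV. (\<Sum>b\<in>UNIV. g a b p * conn F b c p) * cox c \<zeta>)" for a
      unfolding sum_mult_assoc coy_def cox_def by (simp add: distrib_left sum.distrib)
    then have "T u \<zeta> = (\<Sum>a\<in>UNIV. u $ a * ((\<Sum>b\<in>UNIV. g a b p * snd \<zeta> $ b)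
        + (\<Sum>c\<in>UNIV. (\<Sum>b\<in>UNIV. g a b p * conn F b c p) * cox c \<zeta>)))"
      unfolding T_def by (simp add: sum_distrib_left mult_ac flip: sum_distrib_left)
    then show ?thesis
      unfolding E_second_derivative[OF assms] N_def
      by (simp add: distrib_left right_diff_distrib sum.distrib sum_subtractf sum_distrib_left mult_ac)
  qed
  have "N a c = N c a" for a c
    unfolding N_def by (rule g_conn_symmetric[OF assms])
  then have "(\<Sum>a\<in>UNIV. \<Sum>c\<in>UNIV. fst \<xi> $ a * cox c \<eta> * N a c)
      = (\<Sum>a\<in>UNIV. \<Sum>c\<in>UNIV. fst \<eta> $ c * cox a \<xi> * N c a)"
    by (simp add: cox_def mult_ac)
  also have "\<dots> = (\<Sum>a\<in>UNIV. \<Sum>c\<in>UNIV. fst \<eta> $ a * cox c \<xi> * N a c)"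
    by (rule sum.swap)
  finally have "T (fst \<xi>) \<eta> - frechet_derivative (\<lambda>z. frechet_derivative E (at z) (0, fst \<xi>)) (at p) \<eta>
      = T (fst \<eta>) \<xi> - frechet_derivative (\<lambda>z. frechet_derivative E (at z) (0, fst \<eta>)) (at p) \<xi>"
    unfolding T .
  moreover have "G p \<xi> (J p \<eta>) = T (fst \<xi>) \<eta> - T (fst \<eta>) \<xi>"
  proof -
    have "(\<Sum>a\<in>UNIV. \<Sum>b\<in>UNIV. g a b p * coy F a p \<xi> * cox b \<eta>) = T (fst \<eta>) \<xi>"
      unfolding T_def cox_def by (subst sum.swap) (simp add: g_commute[OF assms, of a b for a b] mult_ac)
    then show ?thesis
      unfolding G_J_right[OF assms] by (simp add: T_def cox_def)
  qed
  ultimately show ?thesis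
    by simp
qed

lemma closed_form_on_U: "closed_form_on U (\<lambda>p \<xi> \<eta>. G p \<xi> (J p \<eta>))"
  unfolding closed_form_on_def
  by (intro ballI allI, rule ext_deriv_hilbert_form[OF open_U _ smooth_E], assumption, rule G_J_eq)

subsection \<open>Integrability\<close>

lemma hor_fields: "hor F a = (\<lambda>q. (axis a 1, \<chi> d. - conn F d a q))"
  by (simp add: hor_eq fun_eq_iff)

lemma J_hor_fields: "(\<lambda>q. J q (hor F a q)) = (\<lambda>q. (0, \<chi> d. - Pm a d q))"
  by (simp add: J_hor fun_eq_iff prod_eq_iff fst_sum snd_sum vert_def vec_eq_iff axis_def
      if_distrib cong: if_cong)

lemma differentiable_conn: "p \<in> U \<Longrightarrow> conn F a b differentiable (at p)"
  by (rule smooth_on_differentiable[OF smooth_conn])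

lemma differentiable_Pmix: "p \<in> U \<Longrightarrow> Pm a b differentiable (at p)"
  by (rule smooth_on_differentiable[OF smooth_Pmix])

lemma differentiable_hor:
  assumes "p \<in> U"
  shows "hor F a differentiable (at p)"
  unfolding hor_fields
  by (rule differentiableI, rule affine_field_has_derivative)
    (intro differentiable_minus differentiable_conn assms)

lemma differentiable_Jtilde:
  assumes "p \<in> U"
  shows "(\<lambda>q. J q \<xi>) differentiable (at p)"
proof -
  have "(\<lambda>q. coy F a q \<xi>) differentiable (at p)" for a
    unfolding coy_def
    by (auto intro!: differentiable_add differentiable_sum simp: differentiable_conn[OF assms])
  then show ?thesis
    unfolding Jtilde_def vert_def
    by (auto intro!: differentiable_diff differentiable_sum differentiable_scaleR differentiable_hor
        differentiable_Pmix smooth_on_differentiable[OF smooth_Qmix] assms simp del: scaleR_Pair)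
qed

sublocale complex: almost_complex_field U J
  by (rule almost_complex_field.intro) (simp_all add: open_U linear_J J_J differentiable_Jtilde)

text \<open>J sends the horizontal frame to the vertical one through -P, and Q undoes P.\<close>

lemma frame_span:
  assumes "p \<in> U"
  shows "span (range (\<lambda>a. hor F a p) \<union> range (\<lambda>a. J p (hor F a p))) = UNIV" (is "span ?S = _")
proof -
  have vert: "vert a p = - (\<Sum>b\<in>UNIV. Qm a b p *\<^sub>R J p (hor F b p))" for a
    by (rule frame_eqI[of _ _ p])
      (simp_all add: cox_linear coy_linear cox_J coy_J coy_hor cox_hor cox_vert coy_vert sum_delta_mult
        Pmix_Qmix[OF assms] sum_negf)
  have "vert a p \<in> span ?S" for a
    unfolding vert by (intro span_neg span_sum span_scale span_base) auto
  moreover have "hor F a p \<in> span ?S" for a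
    by (intro span_base) auto
  ultimately have "\<xi> \<in> span ?S" for \<xi>
    by (subst frame_expand[of \<xi> p]) (intro span_add span_sum span_scale)
  then show ?thesis
    by blast
qed

definition nij_vert :: "'i \<Rightarrow> 'i \<Rightarrow> 'i \<Rightarrow> 'i pt \<Rightarrow> real" where
  "nij_vert d a b p = (\<Sum>c\<in>UNIV. Pm a c p * dy c (Pm b d) p) - (\<Sum>c\<in>UNIV. Pm b c p * dy c (Pm a d) p)
    - curv F d a b p"

text \<open>Minus the components of the sum of the two mixed brackets. J carries this vertical
  vector to the horizontal part of the Nijenhuis tensor.\<close>

definition nij_hor :: "'i \<Rightarrow> 'i \<Rightarrow> 'i \<Rightarrow> 'i pt \<Rightarrow> real" where
  "nij_hor d a b p = Phder F A B \<tau> d b a p - Phder F A B \<tau> d a b p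
    + (\<Sum>c\<in>UNIV. Pm b c p * dconn F d a c p) - (\<Sum>c\<in>UNIV. Pm a c p * dconn F d c b p)"

lemma lie_bracket_J_hor_J_hor:
  assumes "p \<in> U"
  shows "lie_bracket (\<lambda>q. J q (hor F a q)) (\<lambda>q. J q (hor F b q)) p = (0, \<chi> d.
    (\<Sum>c\<in>UNIV. Pm a c p * dy c (Pm b d) p) - (\<Sum>c\<in>UNIV. Pm b c p * dy c (Pm a d) p))"
  unfolding J_hor_fields
  by (subst lie_bracket_affine_fields)
    (simp_all add: differentiable_Pmix[OF assms] frechet_derivative_uminus frechet_derivative_vertical sum_negf)

lemma lie_bracket_J_hor_hor:
  assumes "p \<in> U"
  shows "lie_bracket (\<lambda>q. J q (hor F a q)) (hor F b) p = (0, \<chi> d.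
    (\<Sum>c\<in>UNIV. Pm a c p * dconn F d b c p) + Phder F A B \<tau> d a b p)"
  \<comment> \<open>This comes before \<open>hor_fields\<close>, whose unfolding would destroy the
    pattern \<open>J q (hor F a q)\<close>.\<close>
  unfolding J_hor_fields
  unfolding Phder_def dconn_def hor_fields
  by (subst lie_bracket_affine_fields)
    (simp_all add: differentiable_Pmix[OF assms] differentiable_conn[OF assms] frechet_derivative_uminus
      frechet_derivative_vertical sum_negf)

text \<open>\<open>curv\<close> names the y-components of this very bracket, so the content is that
  the x-components vanish.\<close>

lemma lie_bracket_hor_hor:
  assumes "p \<in> U"
  shows "lie_bracket (hor F a) (hor F b) p = (0, \<chi> d. curv F d a b p)"
  unfolding curv_def hor_fields
  by (subst (1 2) lie_bracket_affine_fields) (simp_all add: differentiable_conn[OF assms])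

lemma nijenhuis_hor_hor:
  assumes "p \<in> U"
  shows "nijenhuis J (hor F a) (hor F b) p = (0, \<chi> d. nij_vert d a b p) + J p (0, \<chi> d. nij_hor d a b p)"
proof -
  let ?X = "lie_bracket (\<lambda>q. J q (hor F a q)) (hor F b) p"
    and ?Y = "lie_bracket (hor F a) (\<lambda>q. J q (hor F b q)) p"
  \<comment> \<open>\<open>?Y\<close> is minus the bracket \<open>?X\<close> with a and b exchanged;
    symmetry of the lower indices of \<open>dconn\<close> then matches the index order in
    \<open>nij_hor\<close>.\<close>
  have "?X + ?Y = - (0, \<chi> d. nij_hor d a b p)"
    unfolding lie_bracket_commute[of "hor F a"] lie_bracket_J_hor_hor[OF assms] nij_hor_def
      dconn_commute[OF assms, of _ _ b]
    by (simp add: prod_eq_iff vec_eq_iff)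
  then have "J p ?X + J p ?Y = - J p (0, \<chi> d. nij_hor d a b p)"
    by (simp only: linear_add[OF linear_J[of p], symmetric] linear_neg[OF linear_J[of p]])
  then have "nijenhuis J (hor F a) (hor F b) p
      = lie_bracket (\<lambda>q. J q (hor F a q)) (\<lambda>q. J q (hor F b q)) p - lie_bracket (hor F a) (hor F b) p
        + J p (0, \<chi> d. nij_hor d a b p)"
    unfolding nijenhuis_def by (simp add: algebra_simps)
  then show ?thesis
    unfolding lie_bracket_J_hor_J_hor[OF assms] lie_bracket_hor_hor[OF assms]
    by (simp add: nij_vert_def prod_eq_iff vec_eq_iff)
qed

text \<open>J maps vertical vectors to horizontal ones, injectively because P inverts Q, and the two
  distributions are complementary. This lets one vector equation split into the two families of the
  theorem.\<close>

lemma vertical_plus_J_vertical_eq_0_iff: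
  assumes "p \<in> U"
  shows "(0, v) + J p (0, w) = 0 \<longleftrightarrow> v = 0 \<and> w = 0"
proof
  assume eq: "(0, v) + J p (0, w) = 0"
  have "(\<Sum>a\<in>UNIV. w $ a * Qm a b p) = 0" for b
    using arg_cong[OF eq, of "cox b"] by (simp add: cox_linear(1) cox_J) (simp add: cox_def coy_def)
  then have "(\<Sum>b\<in>UNIV. (\<Sum>a\<in>UNIV. w $ a * Qm a b p) * Pm b c p) = 0" for c
    by simp
  then have w: "w = 0"
    unfolding sum_mult_assoc Pmix_Qmix[OF assms] sum_delta_mult by (simp add: vec_eq_iff)
  then have "(0, v) = 0"
    using eq linear_0[OF linear_J[of p]] by (simp add: zero_prod_def)
  with w show "v = 0 \<and> w = 0"
    by (simp add: zero_prod_def)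
next
  assume "v = 0 \<and> w = 0"
  then show "(0, v) + J p (0, w) = 0"
    using linear_0[OF linear_J[of p]] by (simp add: zero_prod_def)
qed

theorem kahler_on_iff:
  "kahler_on U G J \<longleftrightarrow> (\<forall>p\<in>U. \<forall>a b d. nij_vert d a b p = 0 \<and> nij_hor d a b p = 0)"
proof -
  have "nijenhuis J (hor F a) (hor F b) p = 0 \<longleftrightarrow> (\<forall>d. nij_vert d a b p = 0 \<and> nij_hor d a b p = 0)" if "p \<in> U" for p a b
    unfolding nijenhuis_hor_hor[OF that] vertical_plus_J_vertical_eq_0_iff[OF that]
    by (auto simp: vec_eq_iff)
  moreover have "integrable_on_open U J \<longleftrightarrow> (\<forall>p\<in>U. \<forall>a b. nijenhuis J (hor F a) (hor F b) p = 0)"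
    by (rule complex.integrable_on_open_iff_frame) (auto intro: differentiable_hor simp: frame_span)
  ultimately show ?thesis
    unfolding kahler_on_def by (simp add: hermitian_on_U closed_form_on_U)
qed

end

section \<open>Induced coordinates on the tangent bundle\<close>

lemma chart_invD:
  assumes "is_chart c" "x \<in> snd c ` fst c"
  shows "chart_inv c x \<in> fst c" "snd c (chart_inv c x) = x"
  using assms(2) unfolding chart_inv_def by (auto intro: inv_into_into f_inv_into_f)

lemma chart_inv_snd: "is_chart c \<Longrightarrow> p \<in> fst c \<Longrightarrow> chart_inv c (snd c p) = p"
  unfolding is_chart_def homeomorphism_def by blast

lemma transition_snd: "is_chart c \<Longrightarrow> p \<in> fst c \<Longrightarrow> transition c c' (snd c p) = snd c' p"
  by (simp add: transition_def chart_inv_snd)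

lemma open_chart_image:
  assumes "is_chart c" "open V"
  shows "open (snd c ` (fst c \<inter> V))"
proof -
  have "snd c ` (fst c \<inter> V) = snd c ` fst c \<inter> chart_inv c -` V"
  proof (intro equalityI subsetI)
    fix x assume "x \<in> snd c ` fst c \<inter> chart_inv c -` V"
    then show "x \<in> snd c ` (fst c \<inter> V)"
      using chart_invD[OF assms(1), of x] by (intro image_eqI[of _ _ "chart_inv c x"]) auto
  qed (use chart_inv_snd[OF assms(1)] in auto)
  then show ?thesis
    using assms unfolding is_chart_def homeomorphism_def by (auto intro: continuous_open_preimage)
qed

lemma smooth_atlasD:
  assumes "smooth_atlas \<A>" "c \<in> \<A>"
  shows "is_chart c" "c' \<in> \<A> \<Longrightarrow> smooth_on (snd c ` (fst c \<inter> fst c')) (transition c c')"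
  using assms unfolding smooth_atlas_def by blast+

lemma transition_differentiable:
  assumes "smooth_atlas \<A>" "c \<in> \<A>" "c' \<in> \<A>" "p \<in> fst c" "p \<in> fst c'"
  shows "transition c c' differentiable (at (snd c p))"
  using smooth_on_differentiable[OF smooth_atlasD(2)[OF assms(1-3)]] assms(4,5) by blast

text \<open>The cocycle identity. The two maps agree on the image of the triple overlap, which is
  open around the point, and this suffices for the chain rule.\<close>

lemma transition_derivative_compose:
  assumes \<A>: "smooth_atlas \<A>" and c: "c \<in> \<A>" "c' \<in> \<A>" "c'' \<in> \<A>"
    and p: "p \<in> fst c" "p \<in> fst c'" "p \<in> fst c''"
  shows "frechet_derivative (transition c c'') (at (snd c p)) v
    = frechet_derivative (transition c' c'') (at (snd c' p)) (frechet_derivative (transition c c') (at (snd c p)) v)"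
proof -
  note ch = smooth_atlasD(1)[OF \<A>]
  have op: "open (snd c ` (fst c \<inter> (fst c' \<inter> fst c'')))"
    using ch[OF c(1)] ch[OF c(2)] ch[OF c(3)]
    by (intro open_chart_image open_Int) (simp_all add: is_chart_def)
  have "frechet_derivative (transition c c'') (at (snd c p))
      = frechet_derivative (transition c' c'' \<circ> transition c c') (at (snd c p))"
    by (rule frechet_derivative_cong_open[OF op]) (use p in \<open>auto simp: transition_snd[OF ch[OF c(1)]] transition_snd[OF ch[OF c(2)]]\<close>)
  also have "\<dots> = frechet_derivative (transition c' c'') (at (snd c' p)) \<circ>
      frechet_derivative (transition c c') (at (snd c p))"
    using transition_differentiable[OF \<A> c(1,2) p(1,2)] transition_differentiable[OF \<A> c(2,3) p(2,3)]
      transition_snd[OF ch[OF c(1)] p(1), of c']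
    by (simp add: frechet_derivative_compose)
  finally show ?thesis
    by simp
qed

lemma transition_derivative_same:
  assumes "is_chart c" "x \<in> snd c ` fst c"
  shows "frechet_derivative (transition c c) (at x) v = v"
proof -
  have "frechet_derivative (transition c c) (at x) = frechet_derivative (\<lambda>z. z) (at x)"
    using assms by (intro frechet_derivative_cong_open[of "snd c ` fst c"])
      (auto simp: is_chart_def transition_snd)
  then show ?thesis
    by simp
qed

text \<open>The cocycle identity makes the components compatible. Homogeneity of F is assumed on the
  bundle, and membership carries it over to coordinates.\<close>

lemma of_coords_tangent_bundle:
  assumes \<A>: "smooth_atlas \<A>" and c: "c \<in> \<A>" and x: "x \<in> snd c ` fst c"
  shows "of_coords \<A> c (x, y) \<in> tangent_bundle \<A>"
proof -
  note p = chart_invD[OF smooth_atlasD(1)[OF \<A> c] x]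
  let ?v = "\<lambda>c'. if c' \<in> \<A> \<and> chart_inv c x \<in> fst c'
    then frechet_derivative (transition c c') (at x) y else 0"
  have "?v \<in> tangent_space \<A> (chart_inv c x)"
    unfolding tangent_space_def
  proof (intro CollectI conjI ballI impI allI)
    fix c' c'' assume "c' \<in> \<A>" "c'' \<in> \<A>" "chart_inv c x \<in> fst c'" "chart_inv c x \<in> fst c''"
    then show "?v c'' = frechet_derivative (transition c' c'') (at (snd c' (chart_inv c x))) (?v c')"
      using transition_derivative_compose[OF \<A> c _ _ p(1), of c' c'' y] by (simp only: p(2) simp_thms if_True)
  qed auto
  then show ?thesis
    by (simp only: of_coords_def tangent_bundle_def mem_Collect_eq prod.case)
qed

lemma of_coords_slit_bundle:
  assumes \<A>: "smooth_atlas \<A>" and c: "c \<in> \<A>" and q: "q \<in> slit_coords c"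
  shows "of_coords \<A> c q \<in> slit_bundle \<A>"
proof -
  obtain x y where xy: "q = (x, y)" "x \<in> snd c ` fst c" "y \<noteq> 0"
    using q by (auto simp: slit_coords_def)
  \<comment> \<open>In the chart \<open>c\<close> itself the Jacobian is the identity, so a nonzero
    y gives a nonzero family.\<close>
  have "snd (of_coords \<A> c q) c = y"
    using xy chart_invD(1)[OF smooth_atlasD(1)[OF \<A> c]] c
      transition_derivative_same[OF smooth_atlasD(1)[OF \<A> c]]
    by (simp add: of_coords_def)
  then have "snd (of_coords \<A> c q) \<noteq> (\<lambda>_. 0)"
    using xy(3) by auto
  then show ?thesis
    using of_coords_tangent_bundle[OF \<A> c xy(2), of y] xy(1)
    by (auto simp: slit_bundle_def split: prod.splits)
qed

lemma of_coords_scale: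
  assumes \<A>: "smooth_atlas \<A>" and c: "c \<in> \<A>" and x: "x \<in> snd c ` fst c"
  shows "of_coords \<A> c (x, t *\<^sub>R y)
    = (fst (of_coords \<A> c (x, y)), \<lambda>c'. t *\<^sub>R snd (of_coords \<A> c (x, y)) c')"
proof -
  note p = chart_invD[OF smooth_atlasD(1)[OF \<A> c] x]
  have "linear (frechet_derivative (transition c c') (at x))" if "c' \<in> \<A>" "chart_inv c x \<in> fst c'" for c'
    using transition_differentiable[OF \<A> c that(1) p(1) that(2)] p(2)
    by (simp add: has_derivative_linear[OF has_frechet_derivative])
  then show ?thesis
    by (auto simp: of_coords_def linear_scale)
qed

lemma open_slit_coords: "is_chart c \<Longrightarrow> open (slit_coords c)"
  by (simp add: slit_coords_def is_chart_def open_Times open_Compl)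

text \<open>Definiteness is restated with second directional derivatives, ready to be added up over
  the factors.\<close>

lemma finsler_manifold_chartD:
  assumes "finsler_manifold \<A> F" "c \<in> \<A>"
  shows "smooth_atlas \<A>" "is_chart c"
    and "smooth_on (slit_coords c) (\<lambda>q. (F (of_coords \<A> c q))\<^sup>2)"
    and "q \<in> slit_coords c \<Longrightarrow> w \<noteq> 0 \<Longrightarrow>
      0 < frechet_derivative (\<lambda>z. frechet_derivative (\<lambda>q. (F (of_coords \<A> c q))\<^sup>2) (at z) (0, w)) (at q) (0, w)"
    and "(x, y) \<in> slit_coords c \<Longrightarrow> 0 < t \<Longrightarrow> F (of_coords \<A> c (x, t *\<^sub>R y)) = t * F (of_coords \<A> c (x, y))"
proof -
  show \<A>: "smooth_atlas \<A>" and c: "is_chart c"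
    using assms by (auto simp: finsler_manifold_def smooth_atlas_def)
  show sm: "smooth_on (slit_coords c) (\<lambda>q. (F (of_coords \<A> c q))\<^sup>2)"
    using assms smooth_on_power2[OF open_slit_coords[OF c], of "F \<circ> of_coords \<A> c"]
    by (simp add: finsler_manifold_def comp_def)
  show "0 < frechet_derivative (\<lambda>z. frechet_derivative (\<lambda>q. (F (of_coords \<A> c q))\<^sup>2) (at z) (0, w)) (at q) (0, w)"
    if "q \<in> slit_coords c" "w \<noteq> 0"
  proof -
    have "0 < (\<Sum>a\<in>UNIV. \<Sum>b\<in>UNIV. gmet (F \<circ> of_coords \<A> c) a b q * w $ a * w $ b)"
      using assms that by (simp add: finsler_manifold_def)
    then show ?thesis
      using gmet_quadratic[OF open_slit_coords[OF c] that(1), of "F \<circ> of_coords \<A> c" w] sm by simp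
  qed
  show "F (of_coords \<A> c (x, t *\<^sub>R y)) = t * F (of_coords \<A> c (x, y))"
    if "(x, y) \<in> slit_coords c" "0 < t"
  proof -
    have x: "x \<in> snd c ` fst c"
      using that(1) by (simp add: slit_coords_def)
    obtain p v where pv: "of_coords \<A> c (x, y) = (p, v)"
      by fastforce
    have "F (p, \<lambda>c. t *\<^sub>R v c) = t * F (p, v)"
      using assms(1) of_coords_tangent_bundle[OF \<A> assms(2) x, of y] that(2) pv
      by (auto simp: finsler_manifold_def)
    then show ?thesis
      using of_coords_scale[OF \<A> assms(2) x, of t y] pv by simp
  qed
qed

section \<open>The warped product\<close>

lemma linear_vfst: "linear vfst" and linear_vsnd: "linear vsnd"
  by (intro linearI; simp add: vfst_def vsnd_def vec_eq_iff)+

lemma bounded_linear_vfst: "bounded_linear vfst" and bounded_linear_vsnd: "bounded_linear vsnd"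
  by (simp_all add: linear_vfst linear_vsnd linear_conv_bounded_linear[symmetric])

lemma vfst_vsnd_eq_0: "vfst w = 0 \<Longrightarrow> vsnd w = 0 \<Longrightarrow> w = 0"
  unfolding vfst_def vsnd_def vec_eq_iff by (metis sum.exhaust vec_lambda_beta zero_index)

definition pt_fst :: "('n::finite + 'm::finite) pt \<Rightarrow> 'n pt" where
  "pt_fst p = (vfst (fst p), vfst (snd p))"

definition pt_snd :: "('n::finite + 'm::finite) pt \<Rightarrow> 'm pt" where
  "pt_snd p = (vsnd (fst p), vsnd (snd p))"

lemma bounded_linear_pt_fst: "bounded_linear pt_fst" and bounded_linear_pt_snd: "bounded_linear pt_snd"
  unfolding pt_fst_def[abs_def] pt_snd_def[abs_def]
  by (intro bounded_linear_Pair bounded_linear_compose[OF bounded_linear_vfst]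
      bounded_linear_compose[OF bounded_linear_vsnd] bounded_linear_fst bounded_linear_snd)+

lemma prod_slit_coords_eq: "prod_slit_coords c\<^sub>1 c\<^sub>2 = pt_fst -` slit_coords c\<^sub>1 \<inter> pt_snd -` slit_coords c\<^sub>2"
  by (auto simp: prod_slit_coords_def pt_fst_def pt_snd_def)

lemma open_prod_slit_coords:
  assumes "is_chart c\<^sub>1" "is_chart c\<^sub>2"
  shows "open (prod_slit_coords c\<^sub>1 c\<^sub>2)"
  unfolding prod_slit_coords_eq
  by (intro open_Int open_vimage open_slit_coords assms linear_continuous_on
      bounded_linear_pt_fst bounded_linear_pt_snd)

text \<open>\<open>v\<close> will be a vertical direction and \<open>l\<^sub>0\<close> the
  projection to the base of the first factor, so the warping function behaves like a constant under
  differentiation.\<close>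

lemma warped_derivative:
  fixes K\<^sub>1 K\<^sub>2 \<phi> :: "_ \<Rightarrow> real"
  assumes l: "bounded_linear l\<^sub>1" "bounded_linear l\<^sub>0" "bounded_linear l\<^sub>2" and "l\<^sub>0 v = 0"
    and "K\<^sub>1 differentiable (at (l\<^sub>1 p))" "\<phi> differentiable (at (l\<^sub>0 p))" "K\<^sub>2 differentiable (at (l\<^sub>2 p))"
  shows "frechet_derivative (\<lambda>q. K\<^sub>1 (l\<^sub>1 q) + \<phi> (l\<^sub>0 q) * K\<^sub>2 (l\<^sub>2 q)) (at p) v
    = frechet_derivative K\<^sub>1 (at (l\<^sub>1 p)) (l\<^sub>1 v) + \<phi> (l\<^sub>0 p) * frechet_derivative K\<^sub>2 (at (l\<^sub>2 p)) (l\<^sub>2 v)"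
proof -
  note D = has_derivative_compose[OF bounded_linear_imp_has_derivative has_frechet_derivative]
  have "frechet_derivative \<phi> (at (l\<^sub>0 p)) (l\<^sub>0 v) = 0"
    unfolding assms(4) by (rule linear_0[OF has_derivative_linear[OF has_frechet_derivative[OF assms(6)]]])
  then show ?thesis
    using frechet_derivative_eqI[OF has_derivative_add[OF D[OF l(1) assms(5)]
          has_derivative_mult[OF D[OF l(2) assms(6)] D[OF l(3) assms(7)]]], of v]
    by simp
qed

lemma warped_second_derivative:
  fixes H\<^sub>1 H\<^sub>2 \<phi> :: "_ \<Rightarrow> real"
  assumes l: "bounded_linear l\<^sub>1" "bounded_linear l\<^sub>0" "bounded_linear l\<^sub>2" and l0: "l\<^sub>0 v = 0"
    and S: "open S" "p \<in> S" "l\<^sub>1 ` S \<subseteq> S\<^sub>1" "l\<^sub>0 ` S \<subseteq> S\<^sub>0" "l\<^sub>2 ` S \<subseteq> S\<^sub>2"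
    and sm: "smooth_on S\<^sub>1 H\<^sub>1" "smooth_on S\<^sub>0 \<phi>" "smooth_on S\<^sub>2 H\<^sub>2"
  shows "frechet_derivative (\<lambda>z. frechet_derivative (\<lambda>q. H\<^sub>1 (l\<^sub>1 q) + \<phi> (l\<^sub>0 q) * H\<^sub>2 (l\<^sub>2 q)) (at z) v) (at p) v
    = frechet_derivative (\<lambda>z. frechet_derivative H\<^sub>1 (at z) (l\<^sub>1 v)) (at (l\<^sub>1 p)) (l\<^sub>1 v)
      + \<phi> (l\<^sub>0 p) * frechet_derivative (\<lambda>z. frechet_derivative H\<^sub>2 (at z) (l\<^sub>2 v)) (at (l\<^sub>2 p)) (l\<^sub>2 v)"
proof -
  have in_S: "l\<^sub>1 z \<in> S\<^sub>1" "l\<^sub>0 z \<in> S\<^sub>0" "l\<^sub>2 z \<in> S\<^sub>2" if "z \<in> S" for z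
    using S that by auto
  have "frechet_derivative (\<lambda>z. frechet_derivative (\<lambda>q. H\<^sub>1 (l\<^sub>1 q) + \<phi> (l\<^sub>0 q) * H\<^sub>2 (l\<^sub>2 q)) (at z) v) (at p)
      = frechet_derivative (\<lambda>z. frechet_derivative H\<^sub>1 (at (l\<^sub>1 z)) (l\<^sub>1 v)
          + \<phi> (l\<^sub>0 z) * frechet_derivative H\<^sub>2 (at (l\<^sub>2 z)) (l\<^sub>2 v)) (at p)"
  proof (rule frechet_derivative_cong_open[OF S(1,2)])
    show "frechet_derivative (\<lambda>q. H\<^sub>1 (l\<^sub>1 q) + \<phi> (l\<^sub>0 q) * H\<^sub>2 (l\<^sub>2 q)) (at z) v
        = frechet_derivative H\<^sub>1 (at (l\<^sub>1 z)) (l\<^sub>1 v) + \<phi> (l\<^sub>0 z) * frechet_derivative H\<^sub>2 (at (l\<^sub>2 z)) (l\<^sub>2 v)"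
      if "z \<in> S" for z
      by (rule warped_derivative[OF l l0 smooth_on_differentiable[OF sm(1) in_S(1)[OF that]]
            smooth_on_differentiable[OF sm(2) in_S(2)[OF that]] smooth_on_differentiable[OF sm(3) in_S(3)[OF that]]])
  qed
  then show ?thesis
    using warped_derivative[OF l l0, of "\<lambda>z. frechet_derivative H\<^sub>1 (at z) (l\<^sub>1 v)" p \<phi>
        "\<lambda>z. frechet_derivative H\<^sub>2 (at z) (l\<^sub>2 v)"]
      smooth_on_differentiable[OF smooth_on_deriv[OF sm(1)] in_S(1)[OF S(2)]]
      smooth_on_differentiable[OF sm(2) in_S(2)[OF S(2)]]
      smooth_on_differentiable[OF smooth_on_deriv[OF sm(3)] in_S(3)[OF S(2)]]
    by simp
qed

text \<open>The vertical Hessian of \<open>F^2\<close> is block diagonal with blocks from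
  \<open>F_1^2\<close> and \<open>f^2 F_2^2\<close>; the second block is definite because f vanishes
  nowhere.\<close>

lemma oproiu_chart_warped_product:
  fixes \<A>\<^sub>1 :: "('p::{t2_space,second_countable_topology}, 'n::finite) chart set"
    and \<A>\<^sub>2 :: "('q::{t2_space,second_countable_topology}, 'm::finite) chart set"
    and F\<^sub>1 F\<^sub>2 f
  defines "F \<equiv> warped_product F\<^sub>1 f F\<^sub>2"
  assumes F\<^sub>1: "finsler_manifold \<A>\<^sub>1 F\<^sub>1" and F\<^sub>2: "finsler_manifold \<A>\<^sub>2 F\<^sub>2"
    and f: "smooth_fun \<A>\<^sub>1 f" "\<forall>p. f p \<noteq> 0"
    and "A \<noteq> 0" "B \<noteq> 0" "smooth_on {0<..} \<tau>"
    and nz: "\<forall>z \<in> slit_bundle \<A>\<^sub>1 \<times> slit_bundle \<A>\<^sub>2. B + (F z)\<^sup>2 * \<tau> ((F z)\<^sup>2) \<noteq> 0"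
    and c: "c\<^sub>1 \<in> \<A>\<^sub>1" "c\<^sub>2 \<in> \<A>\<^sub>2"
  shows "oproiu_chart (prod_slit_coords c\<^sub>1 c\<^sub>2) (F \<circ> prod_of_coords \<A>\<^sub>1 \<A>\<^sub>2 c\<^sub>1 c\<^sub>2) A B \<tau>"
proof -
  let ?U = "prod_slit_coords c\<^sub>1 c\<^sub>2" and ?L = "F \<circ> prod_of_coords \<A>\<^sub>1 \<A>\<^sub>2 c\<^sub>1 c\<^sub>2"
  note M\<^sub>1 = finsler_manifold_chartD[OF F\<^sub>1 c(1)] and M\<^sub>2 = finsler_manifold_chartD[OF F\<^sub>2 c(2)]
  define H\<^sub>1 where "H\<^sub>1 q = (F\<^sub>1 (of_coords \<A>\<^sub>1 c\<^sub>1 q))\<^sup>2" for q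
  define H\<^sub>2 where "H\<^sub>2 q = (F\<^sub>2 (of_coords \<A>\<^sub>2 c\<^sub>2 q))\<^sup>2" for q
  define \<phi> where "\<phi> x = (f (chart_inv c\<^sub>1 x))\<^sup>2" for x
  have base: "bounded_linear (\<lambda>p :: ('n + 'm) pt. vfst (fst p))"
    by (rule bounded_linear_compose[OF bounded_linear_vfst bounded_linear_fst])
  \<comment> \<open>The radicand is a sum of nonnegative terms, so squaring cancels the
    root.\<close>
  have L2: "(?L p)\<^sup>2 = H\<^sub>1 (pt_fst p) + \<phi> (vfst (fst p)) * H\<^sub>2 (pt_snd p)" for p
    by (simp add: F_def warped_product_def prod_of_coords_def H\<^sub>1_def H\<^sub>2_def \<phi>_def pt_fst_def pt_snd_def
        of_coords_def case_prod_beta)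
  have opU: "open ?U"
    by (rule open_prod_slit_coords[OF M\<^sub>1(2) M\<^sub>2(2)])
  have sub: "pt_fst ` ?U \<subseteq> slit_coords c\<^sub>1" "pt_snd ` ?U \<subseteq> slit_coords c\<^sub>2"
    "(\<lambda>p. vfst (fst p)) ` ?U \<subseteq> snd c\<^sub>1 ` fst c\<^sub>1"
    by (auto simp: prod_slit_coords_eq) (auto simp: pt_fst_def slit_coords_def)
  have sm: "smooth_on (slit_coords c\<^sub>1) H\<^sub>1" "smooth_on (slit_coords c\<^sub>2) H\<^sub>2" "smooth_on (snd c\<^sub>1 ` fst c\<^sub>1) \<phi>"
    using M\<^sub>1(2,3) M\<^sub>2(3) f(1) c(1) smooth_on_power2[of "snd c\<^sub>1 ` fst c\<^sub>1" "f \<circ> chart_inv c\<^sub>1"]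
    by (simp_all add: H\<^sub>1_def[abs_def] H\<^sub>2_def[abs_def] \<phi>_def[abs_def] smooth_fun_def is_chart_def comp_def)
  have smL: "smooth_on ?U (\<lambda>q. (?L q)\<^sup>2)"
    unfolding L2
    by (intro smooth_on_add smooth_on_mult opU smooth_on_compose_linear[OF opU bounded_linear_pt_fst sub(1) sm(1)]
        smooth_on_compose_linear[OF opU base sub(3) sm(3)] smooth_on_compose_linear[OF opU bounded_linear_pt_snd sub(2) sm(2)])
  show ?thesis
  proof
    show "open ?U" "smooth_on ?U (\<lambda>q. (?L q)\<^sup>2)" "A \<noteq> 0" "B \<noteq> 0" "smooth_on {0<..} \<tau>"
      by fact+
    fix p assume p: "p \<in> ?U"
    have pU: "pt_fst p \<in> slit_coords c\<^sub>1" "pt_snd p \<in> slit_coords c\<^sub>2"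
      using p sub by auto
    show "snd p \<noteq> 0"
      using pU(1) linear_0[OF linear_vfst] by (auto simp: pt_fst_def slit_coords_def)
    show "B + (?L p)\<^sup>2 * \<tau> ((?L p)\<^sup>2) \<noteq> 0"
      using nz of_coords_slit_bundle[OF M\<^sub>1(1) c(1) pU(1)] of_coords_slit_bundle[OF M\<^sub>2(1) c(2) pU(2)]
      by (auto simp: prod_of_coords_def pt_fst_def pt_snd_def split: prod.splits)
    show "(fst p, t *\<^sub>R snd p) \<in> ?U \<and> (?L (fst p, t *\<^sub>R snd p))\<^sup>2 = t\<^sup>2 * (?L p)\<^sup>2" if t: "0 < t" for t
    proof
      show "(fst p, t *\<^sub>R snd p) \<in> ?U"
        using pU t by (simp add: prod_slit_coords_eq pt_fst_def pt_snd_def slit_coords_def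
            linear_scale[OF linear_vfst] linear_scale[OF linear_vsnd])
      have "H\<^sub>1 (pt_fst (fst p, t *\<^sub>R snd p)) = t\<^sup>2 * H\<^sub>1 (pt_fst p)"
        "H\<^sub>2 (pt_snd (fst p, t *\<^sub>R snd p)) = t\<^sup>2 * H\<^sub>2 (pt_snd p)"
        using pU t M\<^sub>1(5) M\<^sub>2(5)
        by (simp_all add: H\<^sub>1_def H\<^sub>2_def pt_fst_def pt_snd_def linear_scale[OF linear_vfst]
            linear_scale[OF linear_vsnd] power_mult_distrib)
      then show "(?L (fst p, t *\<^sub>R snd p))\<^sup>2 = t\<^sup>2 * (?L p)\<^sup>2"
        unfolding L2 by (simp add: algebra_simps)
    qed
    show "0 < (\<Sum>a\<in>UNIV. \<Sum>b\<in>UNIV. gmet ?L a b p * w $ a * w $ b)" if w: "w \<noteq> 0" for w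
    proof -
      define d\<^sub>1 where "d\<^sub>1 = frechet_derivative (\<lambda>z. frechet_derivative H\<^sub>1 (at z) (0, vfst w)) (at (pt_fst p)) (0, vfst w)"
      define d\<^sub>2 where "d\<^sub>2 = frechet_derivative (\<lambda>z. frechet_derivative H\<^sub>2 (at z) (0, vsnd w)) (at (pt_snd p)) (0, vsnd w)"
      have d: "vfst w \<noteq> 0 \<Longrightarrow> 0 < d\<^sub>1" "vsnd w \<noteq> 0 \<Longrightarrow> 0 < d\<^sub>2"
        using M\<^sub>1(4)[OF pU(1)] M\<^sub>2(4)[OF pU(2)]
        by (simp_all add: d\<^sub>1_def d\<^sub>2_def H\<^sub>1_def[abs_def] H\<^sub>2_def[abs_def])
      \<comment> \<open>Definiteness of the factors concerns nonzero vectors. If one component of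
        \<open>w\<close> vanishes, its Hessian term is 0 by linearity and the other component
        supplies the positivity.\<close>
      moreover have "vfst w = 0 \<Longrightarrow> d\<^sub>1 = 0" "vsnd w = 0 \<Longrightarrow> d\<^sub>2 = 0"
        using linear_0[OF has_derivative_linear[OF has_frechet_derivative[OF
              smooth_on_differentiable[OF smooth_on_deriv[OF sm(1)] pU(1)]]]]
          linear_0[OF has_derivative_linear[OF has_frechet_derivative[OF
              smooth_on_differentiable[OF smooth_on_deriv[OF sm(2)] pU(2)]]]]
        by (simp_all add: d\<^sub>1_def d\<^sub>2_def zero_prod_def)
      moreover have "0 < \<phi> (vfst (fst p))"
        using f(2) by (simp add: \<phi>_def)
      ultimately have "0 < d\<^sub>1 + \<phi> (vfst (fst p)) * d\<^sub>2"
        using vfst_vsnd_eq_0[of w] w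
        by (cases "vfst w = 0"; cases "vsnd w = 0") (auto intro: add_pos_pos mult_pos_pos)
      moreover have "(\<Sum>a\<in>UNIV. \<Sum>b\<in>UNIV. gmet ?L a b p * w $ a * w $ b)
          = 1 / 2 * (d\<^sub>1 + \<phi> (vfst (fst p)) * d\<^sub>2)"
        unfolding gmet_quadratic[OF opU p smL] L2
        using warped_second_derivative[OF bounded_linear_pt_fst base bounded_linear_pt_snd _ opU p
            sub(1,3,2) sm(1,3,2), of "(0, w)"]
        by (simp add: linear_0[OF linear_vfst] linear_0[OF linear_vsnd] d\<^sub>1_def d\<^sub>2_def pt_fst_def pt_snd_def)
      ultimately show ?thesis
        by simp
    qed
  qed
qed

theorem corollary4p2:
  fixes \<A>\<^sub>1 :: "('p::{t2_space,second_countable_topology}, 'n::finite) chart set"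
    and \<A>\<^sub>2 :: "('q::{t2_space,second_countable_topology}, 'm::finite) chart set"
    and F\<^sub>1 :: "'p \<times> ('p, 'n) tvec \<Rightarrow> real"
    and F\<^sub>2 :: "'q \<times> ('q, 'm) tvec \<Rightarrow> real"
    and f :: "'p \<Rightarrow> real"
    and A B :: real
    and \<tau> :: "real \<Rightarrow> real"
  defines "F \<equiv> warped_product F\<^sub>1 f F\<^sub>2"
  defines "L \<equiv> \<lambda>c\<^sub>1 c\<^sub>2. F \<circ> prod_of_coords \<A>\<^sub>1 \<A>\<^sub>2 c\<^sub>1 c\<^sub>2"
  assumes "finsler_manifold \<A>\<^sub>1 F\<^sub>1" and "finsler_manifold \<A>\<^sub>2 F\<^sub>2"
    and "smooth_fun \<A>\<^sub>1 f" and "\<forall>p. f p \<noteq> 0"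
    and "A \<noteq> 0" and "B \<noteq> 0"
    and "smooth_on {0<..} \<tau>"
    and "\<forall>z \<in> slit_bundle \<A>\<^sub>1 \<times> slit_bundle \<A>\<^sub>2. B + (F z)\<^sup>2 * \<tau> ((F z)\<^sup>2) \<noteq> 0"
    and "riemannian_bundle \<A>\<^sub>1 \<A>\<^sub>2 (\<lambda>c\<^sub>1 c\<^sub>2. Gtilde (L c\<^sub>1 c\<^sub>2) A B \<tau>)"
  shows "kahler_bundle \<A>\<^sub>1 \<A>\<^sub>2 (\<lambda>c\<^sub>1 c\<^sub>2. Gtilde (L c\<^sub>1 c\<^sub>2) A B \<tau>) (\<lambda>c\<^sub>1 c\<^sub>2. Jtilde (L c\<^sub>1 c\<^sub>2) A B \<tau>) \<longleftrightarrow>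
    (\<forall>c\<^sub>1\<in>\<A>\<^sub>1. \<forall>c\<^sub>2\<in>\<A>\<^sub>2. \<forall>p\<in>prod_slit_coords c\<^sub>1 c\<^sub>2. \<forall>a b d.
      (\<Sum>c\<in>UNIV. Pmix (L c\<^sub>1 c\<^sub>2) A B \<tau> a c p * dy c (Pmix (L c\<^sub>1 c\<^sub>2) A B \<tau> b d) p)
        - (\<Sum>c\<in>UNIV. Pmix (L c\<^sub>1 c\<^sub>2) A B \<tau> b c p * dy c (Pmix (L c\<^sub>1 c\<^sub>2) A B \<tau> a d) p)
        - curv (L c\<^sub>1 c\<^sub>2) d a b p = 0 \<and>
      Phder (L c\<^sub>1 c\<^sub>2) A B \<tau> d b a p - Phder (L c\<^sub>1 c\<^sub>2) A B \<tau> d a b p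
        + (\<Sum>c\<in>UNIV. Pmix (L c\<^sub>1 c\<^sub>2) A B \<tau> b c p * dconn (L c\<^sub>1 c\<^sub>2) d a c p)
        - (\<Sum>c\<in>UNIV. Pmix (L c\<^sub>1 c\<^sub>2) A B \<tau> a c p * dconn (L c\<^sub>1 c\<^sub>2) d c b p) = 0)"
proof -
  have "kahler_on (prod_slit_coords c\<^sub>1 c\<^sub>2) (Gtilde (L c\<^sub>1 c\<^sub>2) A B \<tau>) (Jtilde (L c\<^sub>1 c\<^sub>2) A B \<tau>) \<longleftrightarrow>
      (\<forall>p\<in>prod_slit_coords c\<^sub>1 c\<^sub>2. \<forall>a b d.
        (\<Sum>c\<in>UNIV. Pmix (L c\<^sub>1 c\<^sub>2) A B \<tau> a c p * dy c (Pmix (L c\<^sub>1 c\<^sub>2) A B \<tau> b d) p)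
          - (\<Sum>c\<in>UNIV. Pmix (L c\<^sub>1 c\<^sub>2) A B \<tau> b c p * dy c (Pmix (L c\<^sub>1 c\<^sub>2) A B \<tau> a d) p)
          - curv (L c\<^sub>1 c\<^sub>2) d a b p = 0 \<and>
        Phder (L c\<^sub>1 c\<^sub>2) A B \<tau> d b a p - Phder (L c\<^sub>1 c\<^sub>2) A B \<tau> d a b p
          + (\<Sum>c\<in>UNIV. Pmix (L c\<^sub>1 c\<^sub>2) A B \<tau> b c p * dconn (L c\<^sub>1 c\<^sub>2) d a c p)
          - (\<Sum>c\<in>UNIV. Pmix (L c\<^sub>1 c\<^sub>2) A B \<tau> a c p * dconn (L c\<^sub>1 c\<^sub>2) d c b p) = 0)"
    if "c\<^sub>1 \<in> \<A>\<^sub>1" "c\<^sub>2 \<in> \<A>\<^sub>2" for c\<^sub>1 c\<^sub>2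
  proof -
    interpret oproiu_chart "prod_slit_coords c\<^sub>1 c\<^sub>2" "L c\<^sub>1 c\<^sub>2" A B \<tau>
      using oproiu_chart_warped_product[OF assms(3-9) _ that] assms(10) by (simp add: F_def L_def)
    show ?thesis
      unfolding kahler_on_iff nij_vert_def nij_hor_def ..
  qed
  then show ?thesis
    unfolding kahler_bundle_def by simp
qed

end
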